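(* $H_5(q)=q^2(q+1)$ for every integer $q\ge2$.
   Context: An ordered real $m$-alphabet is a strictly increasing tuple $T=(t_0<\cdots<t_{m-1})$ of real numbers. For an integer $q\ge1$, an order-preserving integer $q$-model of $T$ is a strictly increasing tuple of integers $S=(s_0<\cdots<s_{m-1})$ such that for every $1\le h\le q$ and all index lists $i_1,\dots,i_h$, $j_1,\dots,j_h$ (repetitions allowed), $\sum_{\nu=1}^h t_{i_\nu}=\sum_{\nu=1}^h t_{j_\nu}$ if and only if $\sum_{\nu=1}^h s_{i_\nu}=\sum_{\nu=1}^h s_{j_\nu}$. The diameter of $S$ is $s_{m-1}-s_0$. $H_m(q)$ denotes the least integer $D$ such that every ordered real $m$-alphabet has an order-preserving integer $q$-model of diameter at most $D$. *)

theory Defs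
  imports Complex_Main
begin

text \<open>
  An $m$-tuple is a function on \<open>nat\<close> of which only the values at \<open>0, \<dots>, m - 1\<close> matter.
  An index list of length $h$ is a list of length $h$ with entries below $m$.
\<close>

definition ordered_alphabet :: "nat \<Rightarrow> (nat \<Rightarrow> real) \<Rightarrow> bool" where
  "ordered_alphabet m t \<longleftrightarrow> strict_mono_on {..<m} t"

definition order_preserving_model :: "nat \<Rightarrow> nat \<Rightarrow> (nat \<Rightarrow> real) \<Rightarrow> (nat \<Rightarrow> int) \<Rightarrow> bool" where
  "order_preserving_model m q t s \<longleftrightarrow>
     strict_mono_on {..<m} s \<and>
     (\<forall>h\<in>{1..q}. \<forall>is js.
        length is = h \<and> set is \<subseteq> {..<m} \<and> length js = h \<and> set js \<subseteq> {..<m} \<longrightarrow>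
        ((\<Sum>i\<leftarrow>is. t i) = (\<Sum>j\<leftarrow>js. t j) \<longleftrightarrow> (\<Sum>i\<leftarrow>is. s i) = (\<Sum>j\<leftarrow>js. s j)))"

text \<open>Meaningful for \<open>m \<ge> 1\<close>.\<close>

definition diameter_of :: "nat \<Rightarrow> (nat \<Rightarrow> int) \<Rightarrow> int" where
  "diameter_of m s = s (m - 1) - s 0"

definition diameter_bound :: "nat \<Rightarrow> nat \<Rightarrow> int \<Rightarrow> bool" where
  "diameter_bound m q D \<longleftrightarrow>
     (\<forall>t. ordered_alphabet m t \<longrightarrow>
        (\<exists>s. order_preserving_model m q t s \<and> diameter_of m s \<le> D))"

text \<open>
  \<open>LEAST\<close> is unspecified when no bound exists, so an equation for \<open>H m q\<close> is informative only
  together with \<open>diameter_bound m q (H m q)\<close>. For \<open>m \<ge> 1\<close> every bound is nonnegative, hence a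
  least one exists as soon as there is any.
\<close>

definition H :: "nat \<Rightarrow> nat \<Rightarrow> int" where
  "H m q = (LEAST D. diameter_bound m q D)"

end

theory Submission
  imports Defs "HOL-Analysis.Analysis"
begin

text \<open>
  Write an alphabet through its gap vector \<open>x\<close> in the positive orthant of dimension 4. The
  comparisons of length at most \<open>q\<close> become the integer functionals \<open>c\<close> for which the sequence
  \<open>0, c1, c2, c3, c4, 0\<close> has total variation at most \<open>2 q\<close>, and a model is a positive integral
  vector lying on the same hyperplanes of this arrangement; its diameter is the sum of its coordinates.
  Rays cut out by three such functionals are bounded by a determinant: the coefficients of the
  three inner elements lie in \<open>q\<close> times the convex hull of a totally unimodular set, so the primitive
  vector has coordinate sum at most \<open>q^3\<close>, and at most \<open>q^2\<close>, \<open>q\<close> on facets of codimension 1, 2.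

  If the relations of the alphabet have rank 3, the ray itself is a model. If they have rank 2, the sum
  of a boundary ray and the adjacent ray is one, of size at most \<open>q^2 + q^3\<close>. In rank 0 the gaps
  \<open>1, q, q^2, q^3 - q - 1\<close> work. In rank 1 one adds to a generic point \<open>p\<close> of a facet a vertex of the
  chamber next to it, of size at most \<open>q^3\<close>, so that \<open>p\<close> of size at most \<open>q^2\<close> suffices. The adjacent-ray
  construction inside the facet gives \<open>k (q + 1)\<close>, where \<open>k\<close> is the norm of the contracted relation;
  this is at most \<open>q^2 - 1\<close> as soon as the contracted gap is a strict local extremum of the relation. The few
  relations without such a gap are treated by explicit points.

  For the lower bound take \<open>0, 1, q + 1, q (q + 1), q^2 (q + 1)\<close>: the relations \<open>q t2 = t3\<close> and
  \<open>q t3 = t4\<close> must survive, and a model with \<open>b = s2 - s0 \<le> q\<close> would satisfy a spurious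
  relation of length \<open>b\<close> between the first three elements.
\<close>

section \<open>Determinant bounds\<close>

type_synonym vec4 = "real \<times> real \<times> real \<times> real"

text \<open>Signed maximal minors of the matrix with rows \<open>a\<close>, \<open>b\<close>,
  \<open>c\<close>, so that \<open>x \<bullet> cross4 a b c\<close> is the determinant of the rows
  \<open>x\<close>, \<open>a\<close>, \<open>b\<close>, \<open>c\<close>.\<close>

fun cross4 :: "vec4 \<Rightarrow> vec4 \<Rightarrow> vec4 \<Rightarrow> vec4" where
  "cross4 (a1, a2, a3, a4) (b1, b2, b3, b4) (c1, c2, c3, c4) =
    (a2 * (b3 * c4 - b4 * c3) - a3 * (b2 * c4 - b4 * c2) + a4 * (b2 * c3 - b3 * c2),
     - (a1 * (b3 * c4 - b4 * c3) - a3 * (b1 * c4 - b4 * c1) + a4 * (b1 * c3 - b3 * c1)),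
     a1 * (b2 * c4 - b4 * c2) - a2 * (b1 * c4 - b4 * c1) + a4 * (b1 * c2 - b2 * c1),
     - (a1 * (b2 * c3 - b3 * c2) - a2 * (b1 * c3 - b3 * c1) + a3 * (b1 * c2 - b2 * c1)))"

lemma inner_cross4:
  "a \<bullet> cross4 a b c = 0" "b \<bullet> cross4 a b c = 0" "c \<bullet> cross4 a b c = 0"
  by (cases a; cases b; cases c; simp add: algebra_simps)+

text \<open>The right-hand side is the Gram determinant of \<open>a\<close>, \<open>b\<close>,
  \<open>c\<close>.\<close>

lemma norm_cross4:
  "cross4 a b c \<bullet> cross4 a b c =
    (a \<bullet> a) * ((b \<bullet> b) * (c \<bullet> c) - (b \<bullet> c)\<^sup>2) - (a \<bullet> b) * ((a \<bullet> b) * (c \<bullet> c) - (b \<bullet> c) * (a \<bullet> c))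
    + (a \<bullet> c) * ((a \<bullet> b) * (b \<bullet> c) - (b \<bullet> b) * (a \<bullet> c))"
  by (cases a; cases b; cases c; simp add: algebra_simps power2_eq_square)

lemma cross4_add:
  "cross4 a (b - k *\<^sub>R a) c = cross4 a b c"
  "cross4 a b (c - k *\<^sub>R a - l *\<^sub>R b) = cross4 a b c"
  by (cases a; cases b; cases c; simp add: algebra_simps)+

text \<open>Gram-Schmidt does not change the product (\<open>cross4_add\<close>), and on orthogonal
  vectors the Gram determinant is the product of the squared norms, none of which vanishes.\<close>

lemma cross4_nonzero:
  assumes "independent {a, b, c}" "a \<noteq> b" "a \<noteq> c" "b \<noteq> c"
  shows "cross4 a b c \<noteq> 0"
proof
  assume z: "cross4 a b c = 0"
  have a0: "a \<noteq> 0" using assms(1) dependent_zero by blast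
  define b' where "b' = b - ((a \<bullet> b) / (a \<bullet> a)) *\<^sub>R a"
  have ab: "a \<bullet> b' = 0" using a0 by (simp add: b'_def inner_diff_right)
  have b0: "b' \<noteq> 0"
  proof
    assume "b' = 0"
    then have "b \<in> span {a, c}" unfolding b'_def
      by (metis eq_iff_diff_eq_0 span_base span_scale insertI1)
    moreover have "{a, b, c} - {b} = {a, c}" using assms by auto
    ultimately show False using assms(1) unfolding dependent_def by auto
  qed
  define c' where "c' = c - ((a \<bullet> c) / (a \<bullet> a)) *\<^sub>R a - ((b' \<bullet> c) / (b' \<bullet> b')) *\<^sub>R b'"
  have ac: "a \<bullet> c' = 0" using a0 ab by (simp add: c'_def inner_diff_right)
  have bc: "b' \<bullet> c' = 0" using b0 ab by (simp add: c'_def inner_diff_right inner_commute[of b' a])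
  have c0: "c' \<noteq> 0"
  proof
    assume "c' = 0"
    then have "c = ((a \<bullet> c) / (a \<bullet> a)) *\<^sub>R a + ((b' \<bullet> c) / (b' \<bullet> b')) *\<^sub>R b'"
      unfolding c'_def by (simp add: algebra_simps)
    moreover have "b' \<in> span {a, b}" unfolding b'_def
      by (intro span_diff span_scale span_base) auto
    ultimately have "c \<in> span {a, b}"
      by (metis span_add span_base span_scale insertI1)
    moreover have "{a, b, c} - {c} = {a, b}" using assms by auto
    ultimately show False using assms(1) unfolding dependent_def by auto
  qed
  have "cross4 a b' c' = 0"
    unfolding c'_def cross4_add unfolding b'_def cross4_add by (rule z)
  then have "(a \<bullet> a) * ((b' \<bullet> b') * (c' \<bullet> c')) = 0"
    using norm_cross4[of a b' c'] ab ac bc by simp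
  then show False using a0 b0 c0 by simp
qed

section \<open>Coordinate sums of cross products\<close>

text \<open>The change from positions to gaps turns a relation into its partial sums; the entries of
  \<open>mid_bound\<close> are the coefficients of the three inner elements, and the bound says that neither
  their positive nor their negative part exceeds \<open>k\<close>.\<close>

fun mid_bound :: "vec4 \<Rightarrow> real \<Rightarrow> bool" where
  "mid_bound (c1, c2, c3, c4) k \<longleftrightarrow>
    \<bar>c1 - c2\<bar> \<le> k \<and> \<bar>c2 - c3\<bar> \<le> k \<and> \<bar>c3 - c4\<bar> \<le> k \<and> \<bar>c1 - c3\<bar> \<le> k \<and> \<bar>c2 - c4\<bar> \<le> k \<and>
    \<bar>c1 - c4\<bar> \<le> k \<and> \<bar>(c1 - c2) + (c3 - c4)\<bar> \<le> k"

fun gap_sum :: "vec4 \<Rightarrow> real" where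
  "gap_sum (x1, x2, x3, x4) = x1 + x2 + x3 + x4"

text \<open>For equal signs, \<bar>u1\<bar> + \<bar>u2\<bar> \<le> h and the two products are
  estimated separately. For opposite signs, adding one column to the other replaces the entry of
  larger absolute value by \<open>u1 + u2\<close>; the absolute values of the two new entries add up
  to that of the larger one, again at most \<open>h\<close>.\<close>

lemma det2_bound:
  fixes u1 u2 w1 w2 h k :: real
  assumes "\<bar>u1\<bar> \<le> h" "\<bar>u2\<bar> \<le> h" "\<bar>u1 + u2\<bar> \<le> h" "\<bar>w1\<bar> \<le> k" "\<bar>w2\<bar> \<le> k" "\<bar>w1 + w2\<bar> \<le> k"
  shows "\<bar>u1 * w2 - u2 * w1\<bar> \<le> h * k"
proof -
  have k0: "0 \<le> k" using assms by linarith
  have P: "\<bar>x * y\<bar> \<le> X * k" if "\<bar>x\<bar> \<le> X" "\<bar>y\<bar> \<le> k" for x y X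
    unfolding abs_mult by (rule mult_mono) (use that in auto)
  consider "u1 * u2 \<ge> 0" | "u1 * u2 < 0" "\<bar>u1\<bar> \<le> \<bar>u2\<bar>" | "u1 * u2 < 0" "\<bar>u2\<bar> \<le> \<bar>u1\<bar>" by linarith
  then show ?thesis
  proof cases
    case 1
    then have "\<bar>u1\<bar> + \<bar>u2\<bar> \<le> h" using assms by (auto simp: zero_le_mult_iff)
    moreover have "\<bar>u1 * w2\<bar> \<le> \<bar>u1\<bar> * k" "\<bar>u2 * w1\<bar> \<le> \<bar>u2\<bar> * k" using P assms by auto
    moreover have "(\<bar>u1\<bar> + \<bar>u2\<bar>) * k \<le> h * k" using calculation k0 by (intro mult_right_mono) auto
    ultimately show ?thesis by (simp add: distrib_right)
  next
    case 2
    have e: "u1 * w2 - u2 * w1 = u1 * (w1 + w2) - (u1 + u2) * w1" by (simp add: algebra_simps)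
    have "\<bar>u1 + u2\<bar> + \<bar>u1\<bar> \<le> h" using 2 assms by (auto simp: mult_less_0_iff)
    moreover have "\<bar>u1 * (w1 + w2)\<bar> \<le> \<bar>u1\<bar> * k" "\<bar>(u1 + u2) * w1\<bar> \<le> \<bar>u1 + u2\<bar> * k" using P assms by auto
    moreover have "(\<bar>u1 + u2\<bar> + \<bar>u1\<bar>) * k \<le> h * k" using calculation k0 by (intro mult_right_mono) auto
    ultimately show ?thesis unfolding e by (simp add: distrib_right)
  next
    case 3
    have e: "u1 * w2 - u2 * w1 = (u1 + u2) * w2 - u2 * (w1 + w2)" by (simp add: algebra_simps)
    have "\<bar>u1 + u2\<bar> + \<bar>u2\<bar> \<le> h" using 3 assms by (auto simp: mult_less_0_iff)
    moreover have "\<bar>u2 * (w1 + w2)\<bar> \<le> \<bar>u2\<bar> * k" "\<bar>(u1 + u2) * w2\<bar> \<le> \<bar>u1 + u2\<bar> * k" using P assms by auto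
    moreover have "(\<bar>u1 + u2\<bar> + \<bar>u2\<bar>) * k \<le> h * k" using calculation k0 by (intro mult_right_mono) auto
    ultimately show ?thesis unfolding e by (simp add: distrib_right)
  qed
qed

text \<open>The hypotheses on the \<open>u\<close> say that neither their positive part
  \<open>P\<close> nor their negative part \<open>N\<close> exceeds \<open>h\<close>. The value is
  at most \<open>P\<close> times the maximum minus \<open>N\<close> times the minimum of the
  \<open>z\<close>, hence at most \<open>h\<close> times their spread.\<close>

lemma inner3_bound:
  fixes u1 u2 u3 z1 z2 z3 h M :: real
  assumes u: "\<bar>u1\<bar> \<le> h" "\<bar>u2\<bar> \<le> h" "\<bar>u3\<bar> \<le> h" "\<bar>u1 + u2\<bar> \<le> h" "\<bar>u1 + u3\<bar> \<le> h" "\<bar>u2 + u3\<bar> \<le> h"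
      "\<bar>u1 + u2 + u3\<bar> \<le> h"
    and z: "\<bar>z1\<bar> \<le> M" "\<bar>z2\<bar> \<le> M" "\<bar>z3\<bar> \<le> M" "\<bar>z1 - z2\<bar> \<le> M" "\<bar>z1 - z3\<bar> \<le> M" "\<bar>z2 - z3\<bar> \<le> M"
  shows "\<bar>u1 * z1 + u2 * z2 + u3 * z3\<bar> \<le> h * M"
proof -
  \<comment> \<open>With 0 in the set the maximum is nonnegative and the minimum nonpositive, so
    that replacing \<open>P\<close> and \<open>N\<close> by \<open>h\<close> only weakens the
    estimates.\<close>
  define S where "S = {0, z1, z2, z3}"
  have S: "x - y \<le> M" if "x \<in> S" "y \<in> S" for x y
    using that z unfolding S_def by (elim insertE emptyE) auto
  have finS: "finite S" by (simp add: S_def)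
  define mx mn where "mx = Max S" and "mn = Min S"
  have m: "mn \<le> z" "z \<le> mx" if "z \<in> S" for z
    using that finS unfolding mx_def mn_def by simp_all
  have "mx \<in> S" "mn \<in> S"
    unfolding mx_def mn_def by (rule Max_in Min_in; simp add: S_def)+
  then have m': "mx - mn \<le> M" by (rule S)
  have m0: "mn \<le> 0" "0 \<le> mx" using m[of 0] by (simp_all add: S_def)
  note ub = u[THEN abs_le_D1] and lb = u[THEN abs_le_D2]
  have h0: "0 \<le> h" using u(1) by simp
  have ex: "\<exists>p n. p \<ge> 0 \<and> n \<ge> 0 \<and> v = p - n \<and> (p = 0 \<or> n = 0)" for v :: real
    by (rule exI[of _ "max v 0"], rule exI[of _ "max (-v) 0"]) (auto simp: max_def)
  obtain p1 n1 where 1: "p1 \<ge> 0" "n1 \<ge> 0" "u1 = p1 - n1" "p1 = 0 \<or> n1 = 0" using ex by blast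
  obtain p2 n2 where 2: "p2 \<ge> 0" "n2 \<ge> 0" "u2 = p2 - n2" "p2 = 0 \<or> n2 = 0" using ex by blast
  obtain p3 n3 where 3: "p3 \<ge> 0" "n3 \<ge> 0" "u3 = p3 - n3" "p3 = 0 \<or> n3 = 0" using ex by blast
  define P N where "P = p1 + p2 + p3" and "N = n1 + n2 + n3"
  have "P \<le> h"
    using 1(4) 2(4) 3(4) unfolding P_def
    by (elim disjE) (use ub h0 1(1-3) 2(1-3) 3(1-3) in linarith)+
  moreover have "N \<le> h"
    using 1(4) 2(4) 3(4) unfolding N_def
    by (elim disjE) (use lb h0 1(1-3) 2(1-3) 3(1-3) in linarith)+
  moreover have "P \<ge> 0" "N \<ge> 0" unfolding P_def N_def using 1 2 3 by simp_all
  ultimately have PN: "P \<le> h" "N \<le> h" "P \<ge> 0" "N \<ge> 0" by auto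
  have a: "(p - n) * z \<le> p * mx - n * mn" "p * mn - n * mx \<le> (p - n) * z"
    if "z \<in> S" "p \<ge> 0" "n \<ge> 0" for p n z
    using mult_left_mono[OF m(1)[OF that(1)] that(2)] mult_left_mono[OF m(1)[OF that(1)] that(3)]
      mult_left_mono[OF m(2)[OF that(1)] that(2)] mult_left_mono[OF m(2)[OF that(1)] that(3)]
    by (simp_all add: left_diff_distrib)
  have z_in: "z1 \<in> S" "z2 \<in> S" "z3 \<in> S" by (simp_all add: S_def)
  have "u1 * z1 + u2 * z2 + u3 * z3 \<le> P * mx - N * mn"
    using a(1)[OF z_in(1) 1(1,2)] a(1)[OF z_in(2) 2(1,2)] a(1)[OF z_in(3) 3(1,2)]
    unfolding 1(3) 2(3) 3(3) P_def N_def by (simp add: distrib_right left_diff_distrib)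
  moreover have "P * mn - N * mx \<le> u1 * z1 + u2 * z2 + u3 * z3"
    using a(2)[OF z_in(1) 1(1,2)] a(2)[OF z_in(2) 2(1,2)] a(2)[OF z_in(3) 3(1,2)]
    unfolding 1(3) 2(3) 3(3) P_def N_def by (simp add: distrib_right left_diff_distrib)
  moreover have "P * mx \<le> h * mx" "N * mx \<le> h * mx" "P * mn \<ge> h * mn" "N * mn \<ge> h * mn"
    using m0 PN by (auto intro: mult_right_mono mult_right_mono_neg)
  moreover have "h * mx - h * mn \<le> h * M" using mult_left_mono[OF m' h0] by (simp add: right_diff_distrib)
  ultimately show ?thesis by linarith
qed

text \<open>\<open>gap_sum\<close> is the pairing with the all-ones vector, so up to sign this is
  the 3 by 3 determinant of the consecutive differences. It is expanded along the row of
  \<open>a\<close>; the minors of the other two rows, and the differences of these minors, are 2 by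
  2 determinants covered by \<open>det2_bound\<close>.\<close>

lemma gap_sum_cross4_bound:
  assumes "mid_bound a h" "mid_bound b k" "mid_bound c l"
  shows "\<bar>gap_sum (cross4 a b c)\<bar> \<le> h * k * l"
proof -
  obtain a1 a2 a3 a4 where a: "a = (a1, a2, a3, a4)" by (cases a)
  obtain b1 b2 b3 b4 where b: "b = (b1, b2, b3, b4)" by (cases b)
  obtain c1 c2 c3 c4 where c: "c = (c1, c2, c3, c4)" by (cases c)
  define u1 u2 u3 where "u1 = a1 - a2" "u2 = a2 - a3" "u3 = a3 - a4"
  define v1 v2 v3 where "v1 = b1 - b2" "v2 = b2 - b3" "v3 = b3 - b4"
  define w1 w2 w3 where "w1 = c1 - c2" "w2 = c2 - c3" "w3 = c3 - c4"
  note d = u1_u2_u3_def v1_v2_v3_def w1_w2_w3_def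
  define z1 z2 z3 where "z1 = v2 * w3 - v3 * w2" "z2 = v3 * w1 - v1 * w3" "z3 = v1 * w2 - v2 * w1"
  have "gap_sum (cross4 a b c) = - (u1 * z1 + u2 * z2 + u3 * z3)"
    unfolding a b c d z1_z2_z3_def by (simp add: algebra_simps)
  moreover have "\<bar>u1 * z1 + u2 * z2 + u3 * z3\<bar> \<le> h * (k * l)"
  proof (rule inner3_bound)
    show "\<bar>z1\<bar> \<le> k * l" unfolding z1_z2_z3_def
      by (rule det2_bound; use assms(2,3) in \<open>simp add: b c d add.commute\<close>)
    show "\<bar>z2\<bar> \<le> k * l" unfolding z1_z2_z3_def
      by (rule det2_bound; use assms(2,3) in \<open>simp add: b c d add.commute\<close>)
    show "\<bar>z3\<bar> \<le> k * l" unfolding z1_z2_z3_def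
      by (rule det2_bound; use assms(2,3) in \<open>simp add: b c d add.commute\<close>)
    have e: "z1 - z2 = (v1 + v2) * w3 - v3 * (w1 + w2)" "z1 - z3 = v2 * (w1 + w3) - (v1 + v3) * w2"
      "z2 - z3 = (v2 + v3) * w1 - v1 * (w2 + w3)"
      unfolding z1_z2_z3_def by (simp_all add: algebra_simps)
    show "\<bar>z1 - z2\<bar> \<le> k * l" unfolding e
      by (rule det2_bound; use assms(2,3) in \<open>simp add: b c d add.commute\<close>)
    show "\<bar>z1 - z3\<bar> \<le> k * l" unfolding e
      by (rule det2_bound; use assms(2,3) in \<open>simp add: b c d add.commute\<close>)
    show "\<bar>z2 - z3\<bar> \<le> k * l" unfolding e
      by (rule det2_bound; use assms(2,3) in \<open>simp add: b c d add.commute\<close>)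
  qed (use assms(1) in \<open>simp_all add: a d\<close>)
  ultimately show ?thesis by (simp add: mult.assoc)
qed
declare cross4.simps [simp del] mid_bound.simps [simp del]

section \<open>Chambers of the arrangement\<close>

text \<open>\<open>\<sigma>\<close> gives the signs of a cell in \<open>V\<close>. If the tight
  constraints of a point left a second direction, one could move inside the slice where
  \<open>e\<close> is constant until a further constraint becomes tight; so a point with the most
  tight constraints spans an extreme ray.\<close>

lemma extreme_ray:
  fixes C :: "'a::euclidean_space set"
  assumes fin: "finite C" and V: "subspace V" and t: "t \<in> V" "e \<bullet> t > 0"
    and sg: "\<And>c. c \<in> C \<Longrightarrow> \<sigma> c * (c \<bullet> t) \<ge> 0"
    and pointed: "\<And>d. d \<in> V \<Longrightarrow> e \<bullet> d = 0 \<Longrightarrow> d \<noteq> 0 \<Longrightarrow> \<exists>c\<in>C. \<sigma> c * (c \<bullet> d) \<noteq> 0"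
  shows "\<exists>w\<in>V. e \<bullet> w > 0 \<and> (\<forall>c\<in>C. \<sigma> c * (c \<bullet> w) \<ge> 0) \<and>
    (\<forall>d\<in>V. (\<forall>c\<in>C. c \<bullet> w = 0 \<longrightarrow> c \<bullet> d = 0) \<longrightarrow> (\<exists>\<mu>. d = \<mu> *\<^sub>R w))"
proof -
  define Q where "Q = {w \<in> V. e \<bullet> w > 0 \<and> (\<forall>c\<in>C. \<sigma> c * (c \<bullet> w) \<ge> 0)}"
  define tight where "tight w = {c \<in> C. c \<bullet> w = 0}" for w
  have "t \<in> Q" using t sg by (simp add: Q_def)
  moreover have "card (tight w) < Suc (card C)" for w
    using card_mono[OF fin, of "tight w"] by (auto simp: tight_def)
  ultimately obtain w where w: "w \<in> Q" and mx: "\<And>v. v \<in> Q \<Longrightarrow> card (tight v) \<le> card (tight w)"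
    using ex_has_greatest_nat[of "\<lambda>w. w \<in> Q" t "\<lambda>w. card (tight w)" "Suc (card C)"] by blast
  have "\<exists>\<mu>. d = \<mu> *\<^sub>R w" if d: "d \<in> V" "\<forall>c\<in>C. c \<bullet> w = 0 \<longrightarrow> c \<bullet> d = 0" for d
  proof (rule ccontr)
    assume no: "\<not> ?thesis"
    have ew: "e \<bullet> w > 0" and wV: "w \<in> V" using w by (auto simp: Q_def)
    \<comment> \<open>Subtracting a multiple of \<open>w\<close> puts the direction into the kernel
      of \<open>e\<close> without disturbing the tight constraints.\<close>
    define g where "g = d - ((e \<bullet> d) / (e \<bullet> w)) *\<^sub>R w"
    have gV: "g \<in> V" unfolding g_def by (intro subspace_diff V d subspace_scale wV)
    have eg: "e \<bullet> g = 0" using ew by (simp add: g_def inner_diff_right)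
    have g0: "g \<noteq> 0" using no by (auto simp: g_def)
    have gt: "c \<bullet> g = 0" if "c \<in> C" "c \<bullet> w = 0" for c
      using that d by (simp add: g_def inner_diff_right)
    obtain c0 where c0: "c0 \<in> C" "\<sigma> c0 * (c0 \<bullet> g) \<noteq> 0" using pointed[OF gV eg g0] by blast
    \<comment> \<open>The sign makes at least one constraint decrease, so that the ratio test below
      runs over a nonempty set.\<close>
    define f where "f = (if \<sigma> c0 * (c0 \<bullet> g) < 0 then g else - g)"
    have fV: "f \<in> V" using gV V by (simp add: f_def subspace_neg)
    have ef: "e \<bullet> f = 0" using eg by (simp add: f_def)
    have ft: "c \<bullet> f = 0" if "c \<in> C" "c \<bullet> w = 0" for c using gt[OF that] by (simp add: f_def)
    have "\<sigma> c0 * (c0 \<bullet> (- g)) = - (\<sigma> c0 * (c0 \<bullet> g))" by simp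
    then have c0f: "\<sigma> c0 * (c0 \<bullet> f) < 0" using c0(2) unfolding f_def by (smt (verit))
    define B where "B = {c \<in> C. \<sigma> c * (c \<bullet> f) < 0}"
    have B: "finite B" "B \<noteq> {}" using fin c0 c0f by (auto simp: B_def)
    define r where "r c = (\<sigma> c * (c \<bullet> w)) / (- (\<sigma> c * (c \<bullet> f)))" for c
    \<comment> \<open>The largest step length that respects all constraints; the constraint
      attaining it becomes tight.\<close>
    define \<tau> where "\<tau> = Min (r ` B)"
    have "\<tau> \<in> r ` B" unfolding \<tau>_def using B by (intro Min_in) auto
    then obtain c1 where c1: "c1 \<in> B" "\<tau> = r c1" by blast
    have le: "\<tau> \<le> r c" if "c \<in> B" for c unfolding \<tau>_def using that B by simp
    have wc: "\<sigma> c * (c \<bullet> w) \<ge> 0" if "c \<in> C" for c using w that by (simp add: Q_def)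
    have \<tau>0: "\<tau> \<ge> 0"
      unfolding c1 r_def using c1 wc[of c1] by (intro divide_nonneg_nonneg) (auto simp: B_def)
    define v where "v = w + \<tau> *\<^sub>R f"
    have "\<sigma> c * (c \<bullet> v) \<ge> 0" if c: "c \<in> C" for c
    proof (cases "c \<in> B")
      case True
      then have neg: "- (\<sigma> c * (c \<bullet> f)) > 0" by (simp add: B_def)
      have "\<tau> * (- (\<sigma> c * (c \<bullet> f))) \<le> \<sigma> c * (c \<bullet> w)"
        using le[OF True] unfolding r_def pos_le_divide_eq[OF neg] .
      then show ?thesis by (simp add: v_def inner_add_right algebra_simps)
    next
      case False
      then have "\<tau> * (\<sigma> c * (c \<bullet> f)) \<ge> 0" using c \<tau>0 by (simp add: B_def)
      then show ?thesis using wc[OF c] by (simp add: v_def inner_add_right algebra_simps)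
    qed
    then have vQ: "v \<in> Q"
      using V wV fV ew ef by (simp add: Q_def v_def inner_add_right subspace_add subspace_scale)
    have c1': "c1 \<in> C" "\<sigma> c1 * (c1 \<bullet> f) < 0" using c1 by (auto simp: B_def)
    then have "\<sigma> c1 * (c1 \<bullet> v) = 0"
      unfolding v_def c1(2) r_def by (auto simp: inner_add_right algebra_simps divide_simps)
    then have "c1 \<in> tight v" using c1' by (auto simp: tight_def)
    moreover have "c1 \<notin> tight w" using c1' ft by (auto simp: tight_def)
    moreover have "tight w \<subseteq> tight v" using ft by (auto simp: tight_def v_def inner_add_right)
    ultimately have "tight w \<subset> tight v" by blast
    then have "card (tight w) < card (tight v)"
      using fin by (intro psubset_card_mono) (simp_all add: tight_def)
    then show False using mx[OF vQ] by simp
  qed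
  then show ?thesis using w unfolding Q_def by blast
qed

section \<open>Annihilators and bases of hyperplanes\<close>

lemma dim_annihilator:
  fixes S :: "'a::euclidean_space set"
  assumes "independent S"
  shows "dim {x. \<forall>c\<in>S. c \<bullet> x = 0} + card S = DIM('a)"
proof -
  have "orthogonal c x" if "\<forall>c\<in>S. c \<bullet> x = 0" "c \<in> span S" for c x
    using orthogonal_to_span[OF that(2), of x] that(1)
    by (metis inner_commute orthogonal_commute orthogonal_def)
  then have "{x. \<forall>c\<in>S. c \<bullet> x = 0} = {y \<in> UNIV. \<forall>x\<in>span S. orthogonal x y}"
    by (auto simp del: split_paired_All simp: orthogonal_def span_base)
  moreover have "dim {y \<in> UNIV. \<forall>x\<in>span S. orthogonal x y} + dim (span S) = dim (UNIV :: 'a set)"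
    by (rule dim_subspace_orthogonal_to_vectors) auto
  ultimately show ?thesis using dim_eq_card_independent[OF assms] by simp
qed

lemma annihilator_line:
  fixes S :: "'a::euclidean_space set"
  assumes "independent S" "Suc (card S) = DIM('a)" "w \<noteq> 0" "\<And>c. c \<in> S \<Longrightarrow> c \<bullet> w = 0"
    "\<And>c. c \<in> S \<Longrightarrow> c \<bullet> x = 0"
  shows "\<exists>\<mu>. x = \<mu> *\<^sub>R w"
proof -
  have "dim {x. \<forall>c\<in>S. c \<bullet> x = 0} \<le> card {w}" using dim_annihilator[OF assms(1)] assms(2) by simp
  then have "{x. \<forall>c\<in>S. c \<bullet> x = 0} \<subseteq> span {w}"
    using assms by (intro card_ge_dim_independent) auto
  then show ?thesis using assms(5) by (auto simp: span_singleton)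
qed

text \<open>A maximal independent subset of \<open>T\<close> above \<open>A\<close> has the same
  annihilator as \<open>T\<close>, the line through \<open>w\<close>, and the dimension count gives
  its size. Keeping \<open>A\<close> inside lets prescribed relations enter the determinant
  bound.\<close>

lemma extend_to_hyperplane_basis:
  fixes T :: "'a::euclidean_space set"
  assumes A: "A \<subseteq> T" "independent A" and w: "w \<noteq> 0" "\<And>c. c \<in> T \<Longrightarrow> c \<bullet> w = 0"
    and ker: "\<And>d. \<forall>c\<in>T. c \<bullet> d = 0 \<Longrightarrow> \<exists>\<mu>. d = \<mu> *\<^sub>R w"
  obtains B where "A \<subseteq> B" "B \<subseteq> T" "independent B" "Suc (card B) = DIM('a)"
proof -
  obtain B where B: "A \<subseteq> B" "B \<subseteq> T" "independent B" "T \<subseteq> span B"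
    using maximal_independent_subset_extend[OF A] by blast
  have "{x. \<forall>c\<in>B. c \<bullet> x = 0} = span {w}"
  proof (intro equalityI subsetI)
    fix y assume y: "y \<in> {x. \<forall>c\<in>B. c \<bullet> x = 0}"
    have "y \<bullet> c = 0" if "c \<in> T" for c
      using orthogonal_to_span[of c B y] B(4) that y by (auto simp: orthogonal_def inner_commute)
    then show "y \<in> span {w}" using ker[of y] by (auto simp: span_singleton inner_commute)
  next
    fix y assume "y \<in> span {w}"
    then show "y \<in> {x. \<forall>c\<in>B. c \<bullet> x = 0}"
      using w(2) B(2) by (auto simp: span_singleton)
  qed
  then have "Suc (card B) = DIM('a)"
    using dim_annihilator[OF B(3)] w(1) by (simp add: dim_singleton)
  then show ?thesis using that B by blast
qed

section \<open>Integral points on rays\<close>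

fun integral_vec :: "vec4 \<Rightarrow> bool" where
  "integral_vec (x1, x2, x3, x4) \<longleftrightarrow> x1 \<in> \<int> \<and> x2 \<in> \<int> \<and> x3 \<in> \<int> \<and> x4 \<in> \<int>"

lemma integral_cross4:
  "integral_vec a \<Longrightarrow> integral_vec b \<Longrightarrow> integral_vec c \<Longrightarrow> integral_vec (cross4 a b c)"
  by (cases a; cases b; cases c) (simp add: cross4.simps Ints_add Ints_diff Ints_mult Ints_minus)

lemma integral_vec_minus: "integral_vec a \<Longrightarrow> integral_vec (- a)"
  by (cases a) (simp add: Ints_minus)

lemma integral_vec_add: "integral_vec a \<Longrightarrow> integral_vec b \<Longrightarrow> integral_vec (a + b)"
  by (cases a; cases b) (simp add: Ints_add)

lemma gap_sum_simps: "gap_sum (- a) = - gap_sum a" "gap_sum (a + b) = gap_sum a + gap_sum b" "gap_sum (k *\<^sub>R a) = k * gap_sum a"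
  by (cases a; cases b; simp add: algebra_simps)+

text \<open>The cross product of three independent functionals that vanish on \<open>w\<close> is an
  integral vector on its line, of size controlled by \<open>gap_sum_cross4_bound\<close>. The bound
  \<open>h\<close> depends on the functional because coordinates have norm 1, which is what makes
  points on facets small.\<close>

lemma integral_ray:
  fixes w :: vec4
  assumes A: "A \<subseteq> T" "independent A" and w: "w \<noteq> 0" "\<And>c. c \<in> T \<Longrightarrow> c \<bullet> w = 0"
    and ker: "\<And>d. \<forall>c\<in>T. c \<bullet> d = 0 \<Longrightarrow> \<exists>\<mu>. d = \<mu> *\<^sub>R w"
    and int: "\<And>c. c \<in> T \<Longrightarrow> integral_vec c" and h: "\<And>c. c \<in> T \<Longrightarrow> mid_bound c (h c)"
  obtains B k where "A \<subseteq> B" "B \<subseteq> T" "independent B" "card B = 3" "k > 0"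
    "integral_vec (k *\<^sub>R w)" "\<bar>gap_sum (k *\<^sub>R w)\<bar> \<le> (\<Prod>c\<in>B. h c)"
proof -
  obtain B where B: "A \<subseteq> B" "B \<subseteq> T" "independent B" "Suc (card B) = DIM(vec4)"
    using extend_to_hyperplane_basis[OF A w ker] by metis
  then have card: "card B = 3" by simp
  then obtain a b c where abc: "B = {a, b, c}" "a \<noteq> b" "a \<noteq> c" "b \<noteq> c"
    by (auto simp: card_3_iff)
  define x where "x = cross4 a b c"
  have x0: "x \<noteq> 0" unfolding x_def using B(3) abc by (intro cross4_nonzero) auto
  have bd: "\<bar>gap_sum x\<bar> \<le> (\<Prod>c\<in>B. h c)"
    using gap_sum_cross4_bound[of a "h a" b "h b" c "h c"] h B(2) abc by (auto simp: x_def mult.assoc)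
  have ix: "integral_vec x" unfolding x_def using int B(2) abc by (intro integral_cross4) auto
  have "d \<bullet> x = 0" if "d \<in> B" for d
    using that inner_cross4[where a = a and b = b and c = c] by (auto simp: abc(1) x_def)
  then have "\<exists>\<mu>. x = \<mu> *\<^sub>R w"
    using B w by (intro annihilator_line[of B]) auto
  then obtain \<mu> where \<mu>: "x = \<mu> *\<^sub>R w" by blast
  \<comment> \<open>The cross product may point opposite to \<open>w\<close>; the absolute value of
    the factor keeps the direction of \<open>w\<close>.\<close>
  have "integral_vec (\<bar>\<mu>\<bar> *\<^sub>R w) \<and> \<bar>gap_sum (\<bar>\<mu>\<bar> *\<^sub>R w)\<bar> = \<bar>gap_sum x\<bar>"
    using ix integral_vec_minus[OF ix] by (cases "\<mu> \<ge> 0") (auto simp: \<mu> gap_sum_simps abs_mult)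
  moreover have "\<bar>\<mu>\<bar> > 0" using x0 \<mu> by auto
  ultimately show ?thesis using that[of B "\<bar>\<mu>\<bar>"] B card bd by auto
qed

text \<open>The standard basis, used as functionals that cut out the facets of the positive
  orthant.\<close>

definition coords :: "vec4 set" where
  "coords = {(1, 0, 0, 0), (0, 1, 0, 0), (0, 0, 1, 0), (0, 0, 0, 1)}"

definition nonneg_vec :: "vec4 \<Rightarrow> bool" where
  "nonneg_vec x \<longleftrightarrow> (\<forall>e\<in>coords. e \<bullet> x \<ge> 0)"

lemma coords_simps: "finite coords" "e \<in> coords \<Longrightarrow> integral_vec e" "e \<in> coords \<Longrightarrow> mid_bound e 1"
  by (auto simp: coords_def mid_bound.simps)

lemma coord_nonzero: "d \<noteq> 0 \<Longrightarrow> \<exists>e\<in>coords. e \<bullet> d \<noteq> 0"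
  by (cases d) (auto simp: coords_def zero_prod_def)

lemma gap_sum_pos: "nonneg_vec x \<Longrightarrow> x \<noteq> 0 \<Longrightarrow> gap_sum x > 0"
  by (cases x) (auto simp: nonneg_vec_def coords_def zero_prod_def)

lemma gap_sum_inner: "gap_sum x = (1, 1, 1, 1) \<bullet> x"
  by (cases x) simp

lemma nonneg_vec_add: "nonneg_vec x \<Longrightarrow> nonneg_vec y \<Longrightarrow> nonneg_vec (x + y)"
  by (simp add: nonneg_vec_def inner_add_right)

lemma nonneg_vec_scale: "nonneg_vec x \<Longrightarrow> k \<ge> 0 \<Longrightarrow> nonneg_vec (k *\<^sub>R x)"
  by (simp add: nonneg_vec_def)

section \<open>Lifting a point off a facet\<close>

definition annihilator :: "vec4 set \<Rightarrow> vec4 set" where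
  "annihilator A = {x. \<forall>a\<in>A. a \<bullet> x = 0}"

lemma subspace_annihilator: "subspace (annihilator A)"
  unfolding annihilator_def subspace_def by (simp del: split_paired_All add: inner_add_right)

lemma annihilator_arith:
  "x \<in> annihilator A \<Longrightarrow> y \<in> annihilator A \<Longrightarrow> x + y \<in> annihilator A"
  "x \<in> annihilator A \<Longrightarrow> y \<in> annihilator A \<Longrightarrow> x - y \<in> annihilator A"
  "x \<in> annihilator A \<Longrightarrow> k *\<^sub>R x \<in> annihilator A"
  by (simp_all add: subspace_add subspace_diff subspace_scale subspace_annihilator)

text \<open>Moving a generic point \<open>p\<close> of the facet \<open>e \<bullet> x = 0\<close> into the interior: \<open>y\<close> is the sum of
  \<open>p\<close> and a vertex, off the facet, of the cell of the arrangement \<open>C\<close> in which \<open>p + \<epsilon> t\<close> lies.\<close>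

lemma lift_from_facet:
  assumes C: "finite C" "coords \<subseteq> C" "\<And>c. c \<in> C \<Longrightarrow> integral_vec c"
    and A: "independent A" "\<And>c. c \<in> A \<Longrightarrow> integral_vec c"
    and h: "\<And>c. c \<in> A \<union> C \<Longrightarrow> mid_bound c (h c)"
    and e: "e \<in> coords"
    and p: "p \<in> annihilator A" "nonneg_vec p" "integral_vec p" "e \<bullet> p = 0"
    and t: "t \<in> annihilator A" "nonneg_vec t" "e \<bullet> t > 0"
    and gen: "\<And>c x. c \<in> C \<Longrightarrow> c \<bullet> p = 0 \<Longrightarrow> x \<in> annihilator A \<Longrightarrow> e \<bullet> x = 0 \<Longrightarrow> c \<bullet> x = 0"
  obtains B y where "A \<subseteq> B" "B \<subseteq> A \<union> C" "card B = 3" "y \<in> annihilator A" "nonneg_vec y" "integral_vec y"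
    "gap_sum y \<le> gap_sum p + (\<Prod>c\<in>B. h c)"
    "\<And>c x. c \<in> C \<Longrightarrow> c \<bullet> y = 0 \<Longrightarrow> x \<in> annihilator A \<Longrightarrow> c \<bullet> x = 0"
proof -
  let ?V = "annihilator A"
  \<comment> \<open>A functional that is zero at \<open>p\<close> vanishes wherever \<open>e\<close>
    does inside the annihilator, so there it is a multiple of \<open>e\<close>; \<open>t\<close>
    determines the factor.\<close>
  have proportional: "c \<bullet> x = (e \<bullet> x) / (e \<bullet> t) * (c \<bullet> t)" if "c \<in> C" "c \<bullet> p = 0" "x \<in> ?V" for c x
  proof -
    have ker: "x - ((e \<bullet> x) / (e \<bullet> t)) *\<^sub>R t \<in> ?V"
      using that(3) t(1) by (simp add: annihilator_arith)
    have "e \<bullet> (x - ((e \<bullet> x) / (e \<bullet> t)) *\<^sub>R t) = 0"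
      using t(3) by (simp add: inner_diff_right)
    then have "c \<bullet> (x - ((e \<bullet> x) / (e \<bullet> t)) *\<^sub>R t) = 0"
      by (rule gen[OF that(1,2) ker])
    then show ?thesis by (simp add: inner_diff_right)
  qed
  \<comment> \<open>\<open>s\<close> points from \<open>p\<close> slightly towards \<open>t\<close>:
    \<open>N\<close> is so large that no functional nonzero at \<open>p\<close> changes sign, and
    those vanishing at \<open>p\<close> add nothing to the sum because division by 0 gives
    0.\<close>
  define N where "N = (\<Sum>c\<in>C. \<bar>c \<bullet> t\<bar> / \<bar>c \<bullet> p\<bar>)"
  define s where "s = N *\<^sub>R p + t"
  have sg: "(c \<bullet> p) * (c \<bullet> s) \<ge> 0" if "c \<in> C" for c
  proof (cases "c \<bullet> p = 0")
    case False
    have "\<bar>c \<bullet> t\<bar> / \<bar>c \<bullet> p\<bar> \<le> N"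
      unfolding N_def using C(1) that by (intro member_le_sum) auto
    then have "\<bar>c \<bullet> t\<bar> \<le> N * \<bar>c \<bullet> p\<bar>" using False by (simp add: divide_simps)
    then have "\<bar>c \<bullet> t\<bar> * \<bar>c \<bullet> p\<bar> \<le> N * \<bar>c \<bullet> p\<bar> * \<bar>c \<bullet> p\<bar>" by (rule mult_right_mono) simp
    then have "\<bar>(c \<bullet> t) * (c \<bullet> p)\<bar> \<le> N * ((c \<bullet> p) * (c \<bullet> p))" by (simp add: abs_mult mult.assoc)
    then show ?thesis by (simp add: s_def inner_add_right algebra_simps abs_le_iff)
  qed simp
  have sV: "s \<in> ?V" unfolding s_def using p(1) t(1) by (simp add: annihilator_arith)
  have es: "e \<bullet> s > 0" using p t by (simp add: s_def inner_add_right)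
  have pointed: "\<exists>c\<in>C. (c \<bullet> p) * (c \<bullet> d) \<noteq> 0" if d: "d \<in> ?V" "e \<bullet> d = 0" "d \<noteq> 0" for d
  proof -
    obtain c where "c \<in> coords" "c \<bullet> d \<noteq> 0" using coord_nonzero[OF d(3)] by blast
    then show ?thesis using gen[of c d] d C(2) by (metis mult_eq_0_iff subsetD)
  qed
  obtain w where w: "w \<in> ?V" "e \<bullet> w > 0" "\<And>c. c \<in> C \<Longrightarrow> (c \<bullet> p) * (c \<bullet> w) \<ge> 0"
    and ray: "\<And>d. d \<in> ?V \<Longrightarrow> \<forall>c\<in>C. c \<bullet> w = 0 \<longrightarrow> c \<bullet> d = 0 \<Longrightarrow> \<exists>\<mu>. d = \<mu> *\<^sub>R w"
    using extreme_ray[OF C(1) subspace_annihilator sV es sg pointed] by blast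
  define T where "T = A \<union> {c \<in> C. c \<bullet> w = 0}"
  have "w \<noteq> 0" using w(2) by auto
  then obtain B k where B: "A \<subseteq> B" "B \<subseteq> T" "card B = 3" and k: "k > 0" "integral_vec (k *\<^sub>R w)"
    "\<bar>gap_sum (k *\<^sub>R w)\<bar> \<le> (\<Prod>c\<in>B. h c)"
  proof (rule integral_ray[of A T w h, rotated 2])
    show "\<exists>\<mu>. d = \<mu> *\<^sub>R w" if "\<forall>c\<in>T. c \<bullet> d = 0" for d
      using that by (intro ray) (auto simp: T_def annihilator_def)
    show "A \<subseteq> T" "independent A" using A by (auto simp: T_def)
    show "c \<bullet> w = 0" "integral_vec c" "mid_bound c (h c)" if "c \<in> T" for c
      using that w(1) A(2)[of c] C(3)[of c] h[of c] by (auto simp: T_def annihilator_def)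
  qed
  \<comment> \<open>Coordinates positive at \<open>p\<close> keep their sign by the choice of the
    cell; the others are nonnegative multiples of \<open>e\<close> on the annihilator.\<close>
  have nw: "nonneg_vec w" unfolding nonneg_vec_def
  proof
    fix c assume c: "c \<in> coords"
    then have "c \<bullet> p \<ge> 0" using p by (simp add: nonneg_vec_def)
    then consider "c \<bullet> p > 0" | "c \<bullet> p = 0" by linarith
    then show "0 \<le> c \<bullet> w"
    proof cases
      case 1
      then show ?thesis using w(3)[of c] c C(2) by (auto simp: zero_le_mult_iff)
    next
      case 2
      have "c \<bullet> w = (e \<bullet> w) / (e \<bullet> t) * (c \<bullet> t)" using c C(2) by (intro proportional[OF _ 2 w(1)]) auto
      then show ?thesis using w(2) t c by (simp add: nonneg_vec_def)
    qed
  qed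
  define y where "y = p + k *\<^sub>R w"
  \<comment> \<open>No functional of \<open>C\<close> has opposite signs at \<open>p\<close> and
    \<open>w\<close>, so nothing cancels in the sum: a functional that kills \<open>y\<close> kills
    both \<open>p\<close> and \<open>w\<close>, and by proportionality the whole
    annihilator.\<close>
  have "c \<bullet> x = 0" if c: "c \<in> C" "c \<bullet> y = 0" and x: "x \<in> ?V" for c x
  proof (cases "c \<bullet> p = 0")
    case True
    then have "c \<bullet> w = 0" using c k by (simp add: y_def inner_add_right)
    then have "c \<bullet> t = 0" using proportional[OF c(1) True w(1)] w t by simp
    then show ?thesis using proportional[OF c(1) True x] by simp
  next
    case False
    have "(c \<bullet> p) * (c \<bullet> p) + k * ((c \<bullet> p) * (c \<bullet> w)) = (c \<bullet> p) * (c \<bullet> y)"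
      by (simp add: y_def inner_add_right algebra_simps)
    moreover have "(c \<bullet> p) * (c \<bullet> p) > 0" using False not_real_square_gt_zero by blast
    moreover have "k * ((c \<bullet> p) * (c \<bullet> w)) \<ge> 0" using k w(3)[OF c(1)] by simp
    ultimately show ?thesis using c by simp
  qed
  moreover have "y \<in> ?V" unfolding y_def using p(1) w(1) by (simp add: annihilator_arith)
  moreover have "nonneg_vec y" unfolding y_def
    using k nw p by (intro nonneg_vec_add nonneg_vec_scale) auto
  moreover have "integral_vec y" unfolding y_def by (intro integral_vec_add p k)
  moreover have "gap_sum y \<le> gap_sum p + (\<Prod>c\<in>B. h c)" using k by (simp add: y_def gap_sum_simps)
  moreover have "B \<subseteq> A \<union> C" using B by (auto simp: T_def)
  ultimately show ?thesis using that B by blast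
qed

text \<open>A boundary ray of the nonnegative part of the plane is cut out by \<open>a\<close>,
  \<open>b\<close> and a coordinate, so it contains an integral point of size at most
  \<open>h * k\<close>; lifting off it adds at most \<open>h * k * q\<close>. The hypothesis
  \<open>supp\<close> admits coordinates that vanish on the whole plane, as happens when a gap is
  contracted.\<close>

lemma plane_model:
  assumes C: "finite C" "coords \<subseteq> C" "\<And>c. c \<in> C \<Longrightarrow> integral_vec c" "\<And>c. c \<in> C \<Longrightarrow> mid_bound c q"
    and ab: "independent {a, b}" "a \<noteq> b" "integral_vec a" "integral_vec b" "mid_bound a h" "mid_bound b k"
    and t: "t \<in> annihilator {a, b}" "nonneg_vec t" "t \<noteq> 0"
    and supp: "\<And>e x. e \<in> coords \<Longrightarrow> e \<bullet> t = 0 \<Longrightarrow> x \<in> annihilator {a, b} \<Longrightarrow> e \<bullet> x = 0"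
  shows "\<exists>y\<in>annihilator {a, b}. nonneg_vec y \<and> integral_vec y \<and> gap_sum y \<le> h * k * (1 + q) \<and>
    (\<forall>c\<in>C. c \<bullet> y = 0 \<longrightarrow> (\<forall>x\<in>annihilator {a, b}. c \<bullet> x = 0))"
proof -
  let ?V = "annihilator {a, b}"
  have t1: "(1, 1, 1, 1) \<bullet> t > 0" using gap_sum_pos[OF t(2,3)] by (simp add: gap_sum_inner)
  have pointed: "\<exists>c\<in>coords. (c \<bullet> t) * (c \<bullet> d) \<noteq> 0" if d: "d \<in> ?V" "d \<noteq> 0" for d
  proof -
    obtain c where "c \<in> coords" "c \<bullet> d \<noteq> 0" using coord_nonzero[OF d(2)] by blast
    then show ?thesis using supp[of c d] d(1) by (metis mult_eq_0_iff)
  qed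
  obtain w where w: "w \<in> ?V" "(1, 1, 1, 1) \<bullet> w > 0" "\<And>c. c \<in> coords \<Longrightarrow> (c \<bullet> t) * (c \<bullet> w) \<ge> 0"
    and ray: "\<And>d. d \<in> ?V \<Longrightarrow> \<forall>c\<in>coords. c \<bullet> w = 0 \<longrightarrow> c \<bullet> d = 0 \<Longrightarrow> \<exists>\<mu>. d = \<mu> *\<^sub>R w"
    using extreme_ray[OF coords_simps(1) subspace_annihilator t(1) t1, of "\<lambda>c. c \<bullet> t", OF zero_le_square]
      pointed by blast
  have nw: "nonneg_vec w" unfolding nonneg_vec_def
  proof
    fix c assume c: "c \<in> coords"
    then have "c \<bullet> t > 0 \<or> c \<bullet> t = 0" using t by (auto simp: nonneg_vec_def less_eq_real_def)
    then show "0 \<le> c \<bullet> w" using w(3)[OF c] supp[OF c _ w(1)] by (auto simp: zero_le_mult_iff)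
  qed
  have w0: "w \<noteq> 0" using w(2) by auto
  define T where "T = {a, b} \<union> {c \<in> coords. c \<bullet> w = 0}"
  define h0 where "h0 c = (if c = a then h else if c = b then k else 1)" for c
  obtain B l where B: "{a, b} \<subseteq> B" "B \<subseteq> T" "independent B" "card B = 3" and l: "l > 0"
    "integral_vec (l *\<^sub>R w)" "\<bar>gap_sum (l *\<^sub>R w)\<bar> \<le> (\<Prod>c\<in>B. h0 c)"
    using w0
  proof (rule integral_ray[of "{a, b}" T w h0, rotated 2])
    show "\<exists>\<mu>. d = \<mu> *\<^sub>R w" if "\<forall>c\<in>T. c \<bullet> d = 0" for d
      using that by (intro ray) (auto simp: T_def annihilator_def)
    show "{a, b} \<subseteq> T" "independent {a, b}" using ab by (auto simp: T_def)
    show "c \<bullet> w = 0" "integral_vec c" "mid_bound c (h0 c)" if "c \<in> T" for c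
      using that w(1) ab coords_simps(2,3)[of c] by (auto simp: T_def annihilator_def h0_def)
  qed
  have third: "\<exists>c. c \<noteq> a \<and> c \<noteq> b \<and> S = {a, b, c}" if "{a, b} \<subseteq> S" "card S = 3" for S
  proof -
    have "card (S - {a, b}) = 1" using that ab(2) by (subst card_Diff_subset) auto
    then show ?thesis using that(1) by (auto simp: card_1_singleton_iff) blast
  qed
  obtain e where e: "e \<noteq> a" "e \<noteq> b" "B = {a, b, e}" using third[OF B(1,4)] by blast
  have eT: "e \<in> coords" "e \<bullet> w = 0" using B(2) e by (auto simp: T_def)
  define p where "p = l *\<^sub>R w"
  have p: "p \<in> ?V" "nonneg_vec p" "integral_vec p" "e \<bullet> p = 0" "p \<noteq> 0"
    unfolding p_def using w l eT w0 nw by (simp_all add: annihilator_arith nonneg_vec_scale)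
  have tp: "gap_sum p \<le> h * k"
    using l(3) ab(2) e by (auto simp: p_def h0_def)
  have line: "\<exists>\<mu>. x = \<mu> *\<^sub>R p" if "x \<in> ?V" "e \<bullet> x = 0" for x
    using p that B by (intro annihilator_line[of B]) (auto simp: e annihilator_def)
  \<comment> \<open>Otherwise \<open>supp\<close> would make \<open>e\<close> vanish on the whole
    plane, although \<open>a\<close>, \<open>b\<close>, \<open>e\<close> are independent.\<close>
  have "e \<bullet> t \<noteq> 0"
  proof
    assume "e \<bullet> t = 0"
    then have "{x. \<forall>c\<in>{a, b}. c \<bullet> x = 0} = {x. \<forall>c\<in>B. c \<bullet> x = 0}"
      using supp[OF eT(1)] by (auto simp: e annihilator_def)
    then have "dim {x. \<forall>c\<in>{a, b}. c \<bullet> x = 0} = dim {x. \<forall>c\<in>B. c \<bullet> x = 0}" by simp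
    then show False using dim_annihilator[OF ab(1)] dim_annihilator[OF B(3)] B(4) ab(2) by simp
  qed
  then have et: "e \<bullet> t > 0" using t(2) eT by (auto simp: nonneg_vec_def less_eq_real_def)
  define h1 where "h1 c = (if c = a then h else if c = b then k else q)" for c
  obtain y B' where B': "{a, b} \<subseteq> B'" "card B' = 3" and y: "y \<in> ?V" "nonneg_vec y" "integral_vec y"
    "gap_sum y \<le> gap_sum p + (\<Prod>c\<in>B'. h1 c)"
    "\<And>c x. c \<in> C \<Longrightarrow> c \<bullet> y = 0 \<Longrightarrow> x \<in> ?V \<Longrightarrow> c \<bullet> x = 0"
  proof (rule lift_from_facet[of C "{a, b}" h1 e p t])
    show "c \<bullet> x = 0" if "c \<in> C" "c \<bullet> p = 0" "x \<in> ?V" "e \<bullet> x = 0" for c x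
      using line[OF that(3,4)] that(2) by auto
    show "mid_bound c (h1 c)" if "c \<in> {a, b} \<union> C" for c
      using that ab C(4)[of c] by (cases "c = a"; cases "c = b") (simp_all add: h1_def)
    show "integral_vec c" if "c \<in> {a, b}" for c using that ab by auto
  qed (use C ab eT p t et in simp_all)
  obtain c where "c \<noteq> a" "c \<noteq> b" "B' = {a, b, c}" using third[OF B'] by blast
  then have "(\<Prod>c\<in>B'. h1 c) = h * k * q" using ab(2) by (auto simp: h1_def)
  then have "gap_sum y \<le> h * k * (1 + q)" using y(4) tp by (simp add: algebra_simps)
  then show ?thesis using y(1-3,5) by blast
qed

text \<open>The vertex supplied by \<open>lift_from_facet\<close> is cut out by \<open>a\<close>, of
  norm \<open>h\<close>, and two further functionals of norm \<open>q\<close>.\<close>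

lemma lift_line_model:
  assumes C: "finite C" "coords \<subseteq> C" "\<And>c. c \<in> C \<Longrightarrow> integral_vec c" "\<And>c. c \<in> C \<Longrightarrow> mid_bound c q"
    and a: "a \<noteq> 0" "integral_vec a" "mid_bound a h"
    and e: "e \<in> coords"
    and p: "p \<in> annihilator {a}" "nonneg_vec p" "integral_vec p" "e \<bullet> p = 0"
    and t: "t \<in> annihilator {a}" "nonneg_vec t" "e \<bullet> t > 0"
    and gen: "\<And>c x. c \<in> C \<Longrightarrow> c \<bullet> p = 0 \<Longrightarrow> x \<in> annihilator {a} \<Longrightarrow> e \<bullet> x = 0 \<Longrightarrow> c \<bullet> x = 0"
  shows "\<exists>y\<in>annihilator {a}. nonneg_vec y \<and> integral_vec y \<and> gap_sum y \<le> gap_sum p + h * q\<^sup>2 \<and>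
    (\<forall>c\<in>C. c \<bullet> y = 0 \<longrightarrow> (\<forall>x\<in>annihilator {a}. c \<bullet> x = 0))"
proof -
  define h1 where "h1 c = (if c = a then h else q)" for c
  obtain y B where B: "{a} \<subseteq> B" "card B = 3" and y: "y \<in> annihilator {a}" "nonneg_vec y" "integral_vec y"
    "gap_sum y \<le> gap_sum p + (\<Prod>c\<in>B. h1 c)"
    "\<And>c x. c \<in> C \<Longrightarrow> c \<bullet> y = 0 \<Longrightarrow> x \<in> annihilator {a} \<Longrightarrow> c \<bullet> x = 0"
  proof (rule lift_from_facet[of C "{a}" h1 e p t])
    show "c \<bullet> x = 0" if "c \<in> C" "c \<bullet> p = 0" "x \<in> annihilator {a}" "e \<bullet> x = 0" for c x
      using gen that .
    show "mid_bound c (h1 c)" if "c \<in> {a} \<union> C" for c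
      using that a C(4)[of c] by (cases "c = a") (simp_all add: h1_def)
    show "integral_vec c" if "c \<in> {a}" for c using that a by simp
  qed (use C a e p t in simp_all)
  have "finite B" using B by (metis card.infinite zero_neq_numeral)
  then have "(\<Prod>c\<in>B. h1 c) = h1 a * (\<Prod>c\<in>B - {a}. h1 c)" using B by (intro prod.remove) auto
  also have "(\<Prod>c\<in>B - {a}. h1 c) = (\<Prod>c\<in>B - {a}. q)" by (intro prod.cong) (auto simp: h1_def)
  also have "card (B - {a}) = 2" using B by (subst card_Diff_subset) auto
  then have "h1 a * (\<Prod>c\<in>B - {a}. q) = h * q\<^sup>2" by (simp add: h1_def)
  finally have "gap_sum y \<le> gap_sum p + h * q\<^sup>2" using y(4) by simp
  then show ?thesis using y(1-3,5) by blast
qed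

section \<open>Generic points over the integers\<close>

definition variation :: "int \<Rightarrow> int \<Rightarrow> int \<Rightarrow> int \<Rightarrow> int" where
  "variation a b c d = \<bar>a\<bar> + \<bar>a - b\<bar> + \<bar>b - c\<bar> + \<bar>c - d\<bar> + \<bar>d\<bar>"

lemma small_multiple:
  fixes q k x :: int
  assumes "q * k = x" "\<bar>x\<bar> < q * (n + 1)" "q > 0"
  shows "\<bar>k\<bar> \<le> n"
proof -
  have "q * \<bar>k\<bar> = \<bar>x\<bar>" using assms by (simp add: abs_mult flip: assms(1))
  then have "q * \<bar>k\<bar> < q * (n + 1)" using assms(2) by simp
  then show ?thesis using assms(3) by (simp add: mult_less_cancel_left)
qed

lemma abs_le_1_cases: "\<bar>k :: int\<bar> \<le> 1 \<Longrightarrow> k = -1 \<or> k = 0 \<or> k = 1" by linarith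
lemma abs_le_2_cases: "\<bar>k :: int\<bar> \<le> 2 \<Longrightarrow> k = -2 \<or> k = -1 \<or> k = 0 \<or> k = 1 \<or> k = 2" by linarith

lemma abs_add_same_sign: "\<bar>x + y\<bar> = \<bar>x\<bar> + \<bar>y\<bar>" if "x * y \<ge> 0" for x y :: int
  using that by (auto simp: zero_le_mult_iff)

text \<open>As in Horner's scheme the equation is divided by \<open>q\<close> repeatedly. The
  variation bound keeps the quotients \<open>k\<close>, \<open>l\<close> and \<open>d4\<close> in
  {-1, 0, 1}, and each remaining case is linear.\<close>

lemma generic_free:
  fixes q :: int
  assumes q: "q \<ge> 2" and V: "variation d1 d2 d3 d4 \<le> 2 * q"
    and eq: "d1 + q * d2 + q^2 * d3 + (q^3 - q - 1) * d4 = 0"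
  shows "d1 = 0 \<and> d2 = 0 \<and> d3 = 0 \<and> d4 = 0"
proof -
  define l where "l = - (d3 + q * d4)"
  define k where "k = - (d2 + q * d3 + (q^2 - 1) * d4)"
  have 1: "q * k = d1 - d4" using eq by (simp add: k_def algebra_simps power2_eq_square power3_eq_cube)
  have 2: "q * l = d2 - d4 + k" by (simp add: k_def l_def algebra_simps power2_eq_square)
  have 3: "q * d4 = - d3 - l" by (simp add: l_def)
  have k: "\<bar>k\<bar> \<le> 1" using V q by (intro small_multiple[OF 1]) (auto simp: variation_def)
  have l: "\<bar>l\<bar> \<le> 1" using V q k by (intro small_multiple[OF 2]) (auto simp: variation_def)
  have m: "\<bar>d4\<bar> \<le> 1" using V q l by (intro small_multiple[OF 3]) (auto simp: variation_def)
  show ?thesis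
    using abs_le_1_cases[OF k] abs_le_1_cases[OF l] abs_le_1_cases[OF m] 1 2 3 V q
    unfolding variation_def by (elim disjE) simp_all
qed

text \<open>The name encodes the relation (0, r, r, -1) with r = q - 1, of which \<open>d\<close>
  turns out to be a multiple. The division by \<open>q\<close> is that of
  \<open>generic_free\<close>.\<close>

lemma generic_0rr1:
  fixes q :: int
  assumes q: "q \<ge> 2" and V: "variation d1 d2 d3 d4 \<le> 2 * q"
    and eq: "(q^3 - q - 1) * d1 + q * d2 + d3 + (q^2 - 1) * d4 = 0"
  shows "d1 = 0 \<and> d2 = d3 \<and> d2 = - (q - 1) * d4"
proof -
  define l where "l = - (q * d1 + d4)"
  define k where "k = (q^2 - 1) * d1 + d2 + q * d4"
  have 1: "q * k = d1 - d3 + d4" using eq by (simp add: k_def algebra_simps power2_eq_square power3_eq_cube)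
  have 2: "q * l = d2 - d1 - k" by (simp add: k_def l_def algebra_simps power2_eq_square)
  have 3: "q * d1 = - d4 - l" by (simp add: l_def)
  have k: "\<bar>k\<bar> \<le> 1" using V q by (intro small_multiple[OF 1]) (auto simp: variation_def)
  have l: "\<bar>l\<bar> \<le> 1" using V q k by (intro small_multiple[OF 2]) (auto simp: variation_def)
  have m: "\<bar>d1\<bar> \<le> 1" using V q l by (intro small_multiple[OF 3]) (auto simp: variation_def)
  show ?thesis
    using abs_le_1_cases[OF k] abs_le_1_cases[OF l] abs_le_1_cases[OF m] 1 2 3 V q
    unfolding variation_def by (elim disjE) simp_all
qed

text \<open>The same for the relation (r, r, -1, 0) with r = q - 1; here the quotients are bounded
  by 2.\<close>

lemma generic_rr10:
  fixes q :: int
  assumes q: "q \<ge> 2" and V: "variation d1 d2 d3 d4 \<le> 2 * q"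
    and eq: "q * d1 + d2 + (q^2 - 1) * d3 + (q^3 - q - 1) * d4 = 0"
  shows "d4 = 0 \<and> d1 = d2 \<and> d1 = - (q - 1) * d3"
proof -
  define l where "l = - (d3 + q * d4)"
  define k where "k = - (d1 + q * d3 + (q^2 - 1) * d4)"
  have 1: "q * k = d2 - d3 - d4" using eq by (simp add: k_def algebra_simps power2_eq_square power3_eq_cube)
  have 2: "q * l = d1 - d4 + k" by (simp add: k_def l_def algebra_simps power2_eq_square)
  have 3: "q * d4 = - d3 - l" by (simp add: l_def)
  have k: "\<bar>k\<bar> \<le> 2" using V q by (intro small_multiple[OF 1]) (auto simp: variation_def)
  have l: "\<bar>l\<bar> \<le> 2" using V q k by (intro small_multiple[OF 2]) (auto simp: variation_def)
  have m: "\<bar>d4\<bar> \<le> 2" using V q l by (intro small_multiple[OF 3]) (auto simp: variation_def)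
  show ?thesis
    using abs_le_2_cases[OF k] abs_le_2_cases[OF l] abs_le_2_cases[OF m] 1 2 3 V q
    unfolding variation_def by (elim disjE) simp_all
qed

text \<open>The relation (1, 1, -1, -1), with the variation bound for q = 2. Only finitely many
  coefficients are possible.\<close>

lemma generic_1111:
  assumes V: "variation d1 d2 d3 d4 \<le> 4" and eq: "d1 + 4 * d2 + 2 * d3 + 3 * d4 = 0"
  shows "d1 = d2 \<and> d3 = - d1 \<and> d4 = - d1"
proof -
  have "\<bar>d2\<bar> \<le> 2" "\<bar>d3\<bar> \<le> 2" "\<bar>d4\<bar> \<le> 2" using V unfolding variation_def by linarith+
  note c = this[THEN abs_le_2_cases]
  show ?thesis using c V eq unfolding variation_def by (elim disjE) simp_all
qed

text \<open>The nonzero residue \<open>d1 - d2 = q\<close> forces a unimodal relation and hence a definite sign.\<close>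

lemma generic_rrs1_aux:
  fixes q :: int
  assumes q: "q \<ge> 2" and s: "0 \<le> s" and V: "variation d1 d2 d3 d4 \<le> 2 * q" and d: "d1 - d2 = q"
    and eq: "1 + q * d2 + d3 + (q^2 - q + s) * d4 = 0"
  shows False
proof -
  have "d2 \<le> d3" "d3 \<le> d4" "d4 \<le> 0" using V d q unfolding variation_def by linarith+
  moreover have "q * q \<ge> 2 * q" using q by (intro mult_right_mono) auto
  moreover from this have "2 \<le> q^2 - q + s" using q s unfolding power2_eq_square by linarith
  ultimately have "(q^2 - q + s) * d4 \<le> 2 * d4" by (intro mult_right_mono_neg)
  then show False
  proof (cases "d2 = 0")
    case False
    then have "q * d2 \<le> q * (-1)" using \<open>d2 \<le> d3\<close> \<open>d3 \<le> d4\<close> \<open>d4 \<le> 0\<close> q by (intro mult_left_mono) auto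
    then show False using eq \<open>(q^2 - q + s) * d4 \<le> 2 * d4\<close> \<open>d3 \<le> d4\<close> \<open>d4 \<le> 0\<close> q by linarith
  next
    case True
    then have "d4 = 0" "d3 = 0" using \<open>d2 \<le> d3\<close> \<open>d3 \<le> d4\<close> \<open>d4 \<le> 0\<close> by linarith+
    then show False using eq True by simp
  qed
qed

text \<open>The relation is (r, r, s, -1) with r = q - 1. After one division by \<open>q\<close>, a
  nonzero quotient is excluded by \<open>generic_rrs1_aux\<close>, and the quotient 0 leaves one
  free integer besides \<open>d4\<close>.\<close>

lemma generic_rrs1:
  fixes q :: int
  assumes q: "q \<ge> 2" and s: "0 \<le> s" "s \<le> q - 1" and V: "variation d1 d2 d3 d4 \<le> 2 * q"
    and eq: "d1 + (q^2 - 1) * d2 + q * d3 + (q^3 - q^2 + q * s) * d4 = 0"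
  shows "d1 = d2 \<and> d2 = - (q - 1) * d4 \<and> d3 = - s * d4"
proof -
  define k where "k = - (q * d2 + d3 + (q^2 - q + s) * d4)"
  have 1: "q * k = d1 - d2" using eq by (simp add: k_def algebra_simps power2_eq_square power3_eq_cube)
  have k: "\<bar>k\<bar> \<le> 1" using V q by (intro small_multiple[OF 1]) (auto simp: variation_def)
  have "k \<noteq> 1" using generic_rrs1_aux[of q s d1 d2 d3 d4] q s V 1 by (auto simp: k_def)
  moreover have "k \<noteq> -1"
    using generic_rrs1_aux[of q s "-d1" "-d2" "-d3" "-d4"] q s V 1 by (auto simp: k_def variation_def)
  ultimately have k0: "k = 0" using abs_le_1_cases[OF k] by blast
  \<comment> \<open>\<open>K\<close> measures the deviation from \<open>- d4\<close> times the
    relation.\<close>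
  define K where "K = - (d2 + (q - 1) * d4)"
  have d2: "d2 = - K - (q - 1) * d4" by (simp add: K_def)
  have "d3 = - (q * d2) - (q^2 - q + s) * d4" using k0 unfolding k_def by linarith
  then have d3: "d3 = q * K - s * d4" unfolding K_def by (simp add: algebra_simps power2_eq_square)
  have a: "d2 - d3 = - ((q + 1) * K + (q - 1 - s) * d4)" unfolding d2 d3 by (simp add: algebra_simps)
  have b: "d3 - d4 = q * K - (s + 1) * d4" unfolding d3 by (simp add: algebra_simps)
  have "K = 0"
  proof (rule ccontr)
    assume K: "K \<noteq> 0"
    have Kb: "\<bar>(q + 1) * K\<bar> > q" "\<bar>q * K\<bar> \<ge> q"
    proof -
      have K1: "1 \<le> \<bar>K\<bar>" using K by linarith
      have "q < (q + 1) * 1" by simp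
      also have "\<dots> \<le> (q + 1) * \<bar>K\<bar>" using q K1 by (intro mult_left_mono) auto
      finally show "\<bar>(q + 1) * K\<bar> > q" using q by (simp add: abs_mult)
      have "q * 1 \<le> q * \<bar>K\<bar>" using q K1 by (intro mult_left_mono) auto
      then show "\<bar>q * K\<bar> \<ge> q" using q by (simp add: abs_mult)
    qed
    have ab: "\<bar>d2 - d3\<bar> \<le> q" "\<bar>d3 - d4\<bar> \<le> q" using V unfolding variation_def by linarith+
    \<comment> \<open>If \<open>K\<close> and \<open>d4\<close> do not have opposite signs, the two
      terms of \<open>d2 - d3\<close> reinforce each other, otherwise those of
      \<open>d3 - d4\<close> do. The difference concerned then exceeds \<open>q\<close>, which the
      variation forbids.\<close>
    consider "K * d4 \<ge> 0" | "K * d4 < 0" by linarith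
    then show False
    proof cases
      case 1
      have "0 \<le> ((q + 1) * (q - 1 - s)) * (K * d4)" by (rule mult_nonneg_nonneg) (use 1 q s in simp_all)
      also have "\<dots> = ((q + 1) * K) * ((q - 1 - s) * d4)" by (simp add: mult_ac)
      finally have "\<bar>(q + 1) * K + (q - 1 - s) * d4\<bar> = \<bar>(q + 1) * K\<bar> + \<bar>(q - 1 - s) * d4\<bar>"
        by (rule abs_add_same_sign)
      then show False using a ab Kb by linarith
    next
      case 2
      have "0 \<le> (q * (s + 1)) * (K * - d4)" by (rule mult_nonneg_nonneg) (use 2 q s in simp_all)
      also have "\<dots> = (q * K) * ((s + 1) * - d4)" by (simp add: mult_ac)
      finally have "\<bar>q * K + (s + 1) * - d4\<bar> = \<bar>q * K\<bar> + \<bar>(s + 1) * - d4\<bar>"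
        by (rule abs_add_same_sign)
      moreover have "(s + 1) * - d4 \<noteq> 0" using 2 s by auto
      moreover have "q * K + (s + 1) * - d4 = q * K - (s + 1) * d4" by simp
      ultimately show False using b ab Kb by linarith
    qed
  qed
  then show ?thesis using d2 d3 1 k0 by (simp add: algebra_simps)
qed

text \<open>The descent \<open>d2 - d3 = q\<close> uses up half of the variation, so the sequence
  from 0 through \<open>d\<close> back to 0 never falls elsewhere. For \<open>d4 = 0\<close> this
  leaves only \<open>d3 = 0\<close> and \<open>d3 = -1\<close>; for \<open>d4 < 0\<close> the term
  with \<open>q^2\<close> makes the left side of \<open>eq\<close> negative.\<close>

lemma generic_srr1_aux:
  fixes q :: int
  assumes q: "q \<ge> 2" and m: "0 \<le> m" "m \<le> q - 2" and V: "variation d1 d2 d3 d4 \<le> 2 * q" and d: "d2 - d3 = q"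
    and eq: "d1 + (q + 1) + q * d3 + (q^2 - 1 - m) * d4 = 0"
  shows False
proof -
  have o: "0 \<le> d1" "d1 \<le> d3 + q" "d3 \<le> d4" "d4 \<le> 0" using V d q unfolding variation_def by linarith+
  show False
  proof (cases "d4 = 0")
    case True
    then have e: "d1 + (q + 1) + q * d3 = 0" using eq by simp
    have "d3 > -2"
    proof (rule ccontr)
      assume "\<not> ?thesis"
      then have "(q + 1) * d3 \<le> (q + 1) * (-2)" using q by (intro mult_left_mono) auto
      then show False using e o q by (simp add: distrib_right)
    qed
    then have "d3 = 0 \<or> d3 = -1" using o by linarith
    then show False using e o q by auto
  next
    case False
    then have "d4 \<le> -1" "d3 \<le> -1" using o by auto
    define X Y Z where "X = q * q" and "Y = q * d3" and "Z = (X - 1 - m) * d4"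
    have X: "X \<ge> 2 * q" unfolding X_def using q by (intro mult_right_mono) auto
    have "q * d3 \<le> q * (-1)" using q \<open>d3 \<le> -1\<close> by (intro mult_left_mono) auto
    then have Y: "Y \<le> - q" by (simp add: Y_def)
    have "(X - 1 - m) * d4 \<le> (X - 1 - m) * (-1)"
      using X q m \<open>d4 \<le> -1\<close> by (intro mult_left_mono) auto
    then have Z: "Z \<le> - X + 1 + m" by (simp add: Z_def)
    have "d1 + (q + 1) + Y + Z = 0" using eq by (simp add: X_def Y_def Z_def power2_eq_square)
    then show False using X Y Z o \<open>d3 \<le> -1\<close> q m by linarith
  qed
qed

text \<open>The relation is (s, r, r, -1) with r = q - 1 and s = q - 1 - m. The plan is that of
  \<open>generic_rrs1\<close>; a nonzero deviation \<open>K\<close> now makes \<open>d1 - d2\<close>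
  or \<open>d1\<close> exceed \<open>q\<close> in absolute value.\<close>

lemma generic_srr1:
  fixes q :: int
  assumes q: "q \<ge> 2" and m: "0 \<le> m" "m \<le> q - 2" and V: "variation d1 d2 d3 d4 \<le> 2 * q"
    and eq: "q * d1 + (q + 1) * d2 + (q^2 - q - 1) * d3 + (q^3 - q - q * m) * d4 = 0"
  shows "d2 = d3 \<and> d2 = - (q - 1) * d4 \<and> d1 = - (q - 1 - m) * d4"
proof -
  define n where "n = - (d1 + d2 + (q - 1) * d3 + (q^2 - 1 - m) * d4)"
  have 1: "q * n = d2 - d3" using eq by (simp add: n_def algebra_simps power2_eq_square power3_eq_cube)
  have n: "\<bar>n\<bar> \<le> 1" using V q by (intro small_multiple[OF 1]) (auto simp: variation_def)
  have e: "d1 + n * (q + 1) + q * d3 + (q^2 - 1 - m) * d4 = 0"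
  proof -
    have "d2 = d3 + q * n" using 1 by simp
    then show ?thesis by (simp add: n_def algebra_simps)
  qed
  have "n \<noteq> 1" using generic_srr1_aux[of q m d1 d2 d3 d4] q m V 1 e by auto
  moreover have "n \<noteq> -1"
  proof
    assume "n = -1"
    then have "- d1 + (q + 1) + q * (- d3) + (q^2 - 1 - m) * (- d4) = 0"
      using arg_cong[OF e, of uminus] by (simp add: algebra_simps)
    moreover have "variation (- d1) (- d2) (- d3) (- d4) \<le> 2 * q" "- d2 - - d3 = q"
      using V 1 \<open>n = -1\<close> by (auto simp: variation_def)
    ultimately show False using generic_srr1_aux q m by blast
  qed
  ultimately have n0: "n = 0" using abs_le_1_cases[OF n] by blast
  then have d3: "d3 = d2" using 1 by simp
  define K where "K = d2 + (q - 1) * d4"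
  have d2: "d2 = K - (q - 1) * d4" by (simp add: K_def)
  have d1: "d1 = - (q * K + (q - 1 - m) * d4)"
    using e n0 unfolding d3 d2 by (simp add: algebra_simps power2_eq_square)
  have a: "d1 - d2 = - ((q + 1) * K) + m * d4" unfolding d1 d2 by (simp add: algebra_simps)
  have "K = 0"
  proof (rule ccontr)
    assume K: "K \<noteq> 0"
    have Kb: "\<bar>(q + 1) * K\<bar> > q" "\<bar>q * K\<bar> \<ge> q"
    proof -
      have K1: "1 \<le> \<bar>K\<bar>" using K by linarith
      have "q < (q + 1) * 1" by simp
      also have "\<dots> \<le> (q + 1) * \<bar>K\<bar>" using q K1 by (intro mult_left_mono) auto
      finally show "\<bar>(q + 1) * K\<bar> > q" using q by (simp add: abs_mult)
      have "q * 1 \<le> q * \<bar>K\<bar>" using q K1 by (intro mult_left_mono) auto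
      then show "\<bar>q * K\<bar> \<ge> q" using q by (simp add: abs_mult)
    qed
    have ab: "\<bar>d1\<bar> \<le> q" "\<bar>d1 - d2\<bar> \<le> q" using V unfolding variation_def by linarith+
    consider "K * d4 \<le> 0" | "K * d4 > 0" by linarith
    then show False
    proof cases
      case 1
      have "0 \<le> ((q + 1) * m) * (- K * d4)" by (rule mult_nonneg_nonneg) (use 1 q m in simp_all)
      also have "\<dots> = - ((q + 1) * K) * (m * d4)" by (simp add: mult_ac)
      finally have "\<bar>- ((q + 1) * K) + m * d4\<bar> = \<bar>- ((q + 1) * K)\<bar> + \<bar>m * d4\<bar>"
        by (rule abs_add_same_sign)
      then show False using a ab Kb by linarith
    next
      case 2
      have "0 \<le> (q * (q - 1 - m)) * (K * d4)" by (rule mult_nonneg_nonneg) (use 2 q m in simp_all)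
      also have "\<dots> = (q * K) * ((q - 1 - m) * d4)" by (simp add: mult_ac)
      finally have "\<bar>q * K + (q - 1 - m) * d4\<bar> = \<bar>q * K\<bar> + \<bar>(q - 1 - m) * d4\<bar>"
        by (rule abs_add_same_sign)
      moreover have "(q - 1 - m) * d4 \<noteq> 0" using 2 m by auto
      ultimately show False using d1 ab Kb by linarith
    qed
  qed
  then show ?thesis using d1 d2 d3 by (simp add: algebra_simps)
qed

section \<open>Generic points of a facet\<close>

lemma generic_facet_rrp_aux:
  fixes p q r :: int
  assumes p: "p \<ge> 2" "r \<ge> 1" "q = p + r" and V: "\<bar>x\<bar> + \<bar>x - y\<bar> + \<bar>y - z\<bar> + \<bar>z\<bar> \<le> 2 * q"
    and d: "x - y = q" and eq: "1 + p * y + r * z = 0"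
  shows False
proof -
  have o: "y \<le> z" "z \<le> 0" using V d p by linarith+
  then have "r * z \<le> 0" using p by (simp add: mult_nonneg_nonpos)
  moreover have "p * y \<le> 2 * y" using o p by (intro mult_right_mono_neg) auto
  ultimately have "y = 0" using eq o by linarith
  then show False using o eq by simp
qed

text \<open>The point (1, p q - 1, r q) has coordinate sum q^2 and lies on the relation (r, r, -p).
  The conclusion is proportionality to that relation, written without a multiplier because
  \<open>p\<close> and \<open>r\<close> may have a common factor.\<close>

lemma generic_facet_rrp:
  fixes p q r :: int
  assumes p: "p \<ge> 2" "r \<ge> 1" "q = p + r" and V: "\<bar>x\<bar> + \<bar>x - y\<bar> + \<bar>y - z\<bar> + \<bar>z\<bar> \<le> 2 * q"
    and eq: "x + (p * q - 1) * y + r * q * z = 0"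
  shows "x = y \<and> p * x + r * z = 0"
proof -
  define k where "k = - (p * y + r * z)"
  have 1: "q * k = x - y" using eq by (simp add: k_def algebra_simps)
  have k: "\<bar>k\<bar> \<le> 1" using V p by (intro small_multiple[OF 1]) auto
  have "k \<noteq> 1" using generic_facet_rrp_aux[OF p V] 1 by (auto simp: k_def)
  moreover have "k \<noteq> -1"
    using generic_facet_rrp_aux[OF p, of "-x" "-y" "-z"] V 1 by (auto simp: k_def)
  ultimately have "k = 0" using abs_le_1_cases[OF k] by blast
  then show ?thesis using 1 by (simp add: k_def)
qed

section \<open>Sign patterns that decide which gap can be contracted\<close>

definition mixed3 :: "int \<Rightarrow> int \<Rightarrow> int \<Rightarrow> bool" where
  "mixed3 a b c \<longleftrightarrow> (a > 0 \<or> b > 0 \<or> c > 0) \<and> (a < 0 \<or> b < 0 \<or> c < 0)"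

definition peak :: "int \<Rightarrow> int \<Rightarrow> int \<Rightarrow> bool" where
  "peak a b c \<longleftrightarrow> a < b \<and> c < b \<or> b < a \<and> b < c"

text \<open>Up to reversal with change of sign, these families cover the relations with
  \<open>c1 \<ge> 0 \<ge> c4\<close> and at most one zero coefficient in which no strict local
  extremum can be contracted. A contraction must leave coefficients of both signs
  (\<open>mixed3\<close>), so that the facet still contains points with the other gaps
  positive.\<close>

definition special :: "int \<Rightarrow> int \<Rightarrow> int \<Rightarrow> int \<Rightarrow> bool" where
  "special c1 c2 c3 c4 \<longleftrightarrow>
    c1 = c2 \<and> c1 > 0 \<and> c3 < 0 \<and> c4 = 0 \<or>
    c1 = c2 \<and> 0 \<le> c3 \<and> c3 \<le> c1 \<and> c1 > 0 \<and> c4 < 0 \<or>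
    c2 = c3 \<and> 0 \<le> c1 \<and> c1 < c2 \<and> c4 < 0 \<or>
    c1 = c2 \<and> c1 > 0 \<and> c3 = c4 \<and> c4 < 0 \<and> c1 \<le> - c4"

lemma special_relations:
  assumes "c1 \<ge> 0" "c4 \<le> 0" "c1 > 0 \<or> c2 > 0 \<or> c3 > 0" "c2 < 0 \<or> c3 < 0 \<or> c4 < 0"
    and "\<not> (peak 0 c1 c2 \<and> mixed3 c2 c3 c4)" "\<not> (peak c1 c2 c3 \<and> mixed3 c1 c3 c4)"
    "\<not> (peak c2 c3 c4 \<and> mixed3 c1 c2 c4)" "\<not> (peak c3 c4 0 \<and> mixed3 c1 c2 c3)"
    and "\<not> (c1 = 0 \<and> c2 = 0)" "\<not> (c1 = 0 \<and> c3 = 0)" "\<not> (c1 = 0 \<and> c4 = 0)"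
    "\<not> (c2 = 0 \<and> c3 = 0)" "\<not> (c2 = 0 \<and> c4 = 0)" "\<not> (c3 = 0 \<and> c4 = 0)"
  shows "special c1 c2 c3 c4 \<or> special (-c4) (-c3) (-c2) (-c1)"
  using assms unfolding special_def peak_def mixed3_def by (smt (verit))

section \<open>The arrangement of short relations\<close>

definition int_vec :: "int \<Rightarrow> int \<Rightarrow> int \<Rightarrow> int \<Rightarrow> vec4" where
  "int_vec a b c d = (of_int a, of_int b, of_int c, of_int d)"

lemma inner_vec: "int_vec a b c d \<bullet> (x1, x2, x3, x4) = a * x1 + b * x2 + c * x3 + d * x4"
  by (simp add: int_vec_def)

lemma inner_vec_vec: "int_vec a b c d \<bullet> int_vec x y z w = of_int (a * x + b * y + c * z + d * w)"
  by (simp add: int_vec_def)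

lemma integral_vec_vec: "integral_vec (int_vec a b c d)"
  by (simp add: int_vec_def)

lemma integral_vecE:
  assumes "integral_vec v" obtains a b c d where "v = int_vec a b c d"
  using assms by (cases v) (auto simp: int_vec_def elim!: Ints_cases)

definition inner_bound :: "int \<Rightarrow> int \<Rightarrow> int \<Rightarrow> int \<Rightarrow> int \<Rightarrow> bool" where
  "inner_bound c1 c2 c3 c4 k \<longleftrightarrow>
    \<bar>c1 - c2\<bar> \<le> k \<and> \<bar>c2 - c3\<bar> \<le> k \<and> \<bar>c3 - c4\<bar> \<le> k \<and> \<bar>c1 - c3\<bar> \<le> k \<and> \<bar>c2 - c4\<bar> \<le> k \<and>
    \<bar>c1 - c4\<bar> \<le> k \<and> \<bar>(c1 - c2) + (c3 - c4)\<bar> \<le> k"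

lemma mid_bound_vec: "mid_bound (int_vec a b c d) (of_int k) \<longleftrightarrow> inner_bound a b c d k"
  unfolding int_vec_def mid_bound.simps inner_bound_def
  by (simp only: of_int_diff[symmetric] of_int_add[symmetric] of_int_abs[symmetric] of_int_le_iff)

lemma inner_bound_variation: "variation a b c d \<le> 2 * k \<Longrightarrow> inner_bound a b c d k"
  unfolding variation_def inner_bound_def by linarith

definition relations :: "int \<Rightarrow> vec4 set" where
  "relations q = {int_vec a b c d | a b c d. variation a b c d \<le> 2 * q}"

lemma relations_int_vec: "int_vec a b c d \<in> relations q \<longleftrightarrow> variation a b c d \<le> 2 * q"
  by (auto simp: relations_def int_vec_def)

lemma relationsE:
  assumes "v \<in> relations q" obtains a b c d where "v = int_vec a b c d" "variation a b c d \<le> 2 * q"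
  using assms by (auto simp: relations_def)

lemma finite_relations: "finite (relations q)"
proof -
  let ?I = "{- 2 * q..2 * q}"
  have "relations q \<subseteq> (\<lambda>(a, b, c, d). int_vec a b c d) ` (?I \<times> ?I \<times> ?I \<times> ?I)"
  proof
    fix v assume "v \<in> relations q"
    then obtain a b c d where "v = int_vec a b c d" "variation a b c d \<le> 2 * q" by (rule relationsE)
    moreover from this(2) have "\<bar>a\<bar> \<le> 2 * q" "\<bar>b\<bar> \<le> 2 * q" "\<bar>c\<bar> \<le> 2 * q" "\<bar>d\<bar> \<le> 2 * q"
      unfolding variation_def by linarith+
    ultimately show "v \<in> (\<lambda>(a, b, c, d). int_vec a b c d) ` (?I \<times> ?I \<times> ?I \<times> ?I)"
      by (intro image_eqI[of _ _ "(a, b, c, d)"]) auto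
  qed
  then show ?thesis by (rule finite_subset) simp
qed

lemma coords_vec: "coords = {int_vec 1 0 0 0, int_vec 0 1 0 0, int_vec 0 0 1 0, int_vec 0 0 0 1}"
  by (simp add: coords_def int_vec_def)

lemma coords_relations: "q \<ge> 1 \<Longrightarrow> coords \<subseteq> relations q"
  unfolding coords_vec by (simp add: relations_int_vec variation_def)

lemma relations_integral: "c \<in> relations q \<Longrightarrow> integral_vec c"
  by (auto simp: relations_def integral_vec_vec)

lemma relations_mid_bound: "c \<in> relations q \<Longrightarrow> mid_bound c (of_int q)"
  by (auto simp: relations_def mid_bound_vec inner_bound_variation)

section \<open>Small models for a single relation\<close>

definition pos_vec :: "vec4 \<Rightarrow> bool" where
  "pos_vec x \<longleftrightarrow> (\<forall>e\<in>coords. e \<bullet> x > 0)"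

text \<open>Nonnegativity of \<open>y\<close> is enough: \<open>gap_model\<close> recovers
  positivity, since the coordinate functionals are among the relations.\<close>

definition has_small_model :: "int \<Rightarrow> vec4 \<Rightarrow> bool" where
  "has_small_model q a \<longleftrightarrow> (\<exists>y\<in>annihilator {a}. nonneg_vec y \<and> integral_vec y \<and> gap_sum y \<le> of_int (q\<^sup>2 * (q + 1)) \<and>
    (\<forall>c\<in>relations q. \<forall>x\<in>annihilator {a}. c \<bullet> y = 0 \<longrightarrow> c \<bullet> x = 0))"

lemma small_model_uminus: "has_small_model q (- a) \<Longrightarrow> has_small_model q a"
  by (simp add: has_small_model_def annihilator_def)

text \<open>The effect on the gaps of reflecting the alphabet, which sends \<open>t i\<close> to
  \<open>- t (4 - i)\<close>.\<close>

fun rev_vec :: "vec4 \<Rightarrow> vec4" where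
  "rev_vec (a, b, c, d) = (d, c, b, a)"

lemma rev_vec_simps:
  "rev_vec (rev_vec x) = x" "rev_vec x \<bullet> y = x \<bullet> rev_vec y" "integral_vec (rev_vec x) \<longleftrightarrow> integral_vec x"
  "nonneg_vec (rev_vec x) \<longleftrightarrow> nonneg_vec x" "pos_vec (rev_vec x) \<longleftrightarrow> pos_vec x" "gap_sum (rev_vec x) = gap_sum x"
  "rev_vec (int_vec a b c d) = int_vec d c b a"
  by (cases x; cases y; auto simp: nonneg_vec_def pos_vec_def coords_def int_vec_def)+

lemma rev_vec_relations: "c \<in> relations q \<Longrightarrow> rev_vec c \<in> relations q"
  by (erule relationsE) (simp add: rev_vec_simps relations_int_vec variation_def abs_minus_commute)

lemma small_model_rev:
  assumes "has_small_model q (rev_vec a)" shows "has_small_model q a"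
proof -
  obtain y where y: "rev_vec a \<bullet> y = 0" "nonneg_vec y" "integral_vec y" "gap_sum y \<le> of_int (q\<^sup>2 * (q + 1))"
    and gen: "\<And>c x. c \<in> relations q \<Longrightarrow> rev_vec a \<bullet> x = 0 \<Longrightarrow> c \<bullet> y = 0 \<Longrightarrow> c \<bullet> x = 0"
    using assms unfolding has_small_model_def annihilator_def by blast
  have "c \<bullet> x = 0" if "c \<in> relations q" "a \<bullet> x = 0" "c \<bullet> rev_vec y = 0" for c x
    using gen[OF rev_vec_relations[OF that(1)], of "rev_vec x"] that
    by (simp add: rev_vec_simps)
  then show ?thesis
    unfolding has_small_model_def annihilator_def using y
    by (intro bexI[of _ "rev_vec y"] conjI ballI) (simp_all add: rev_vec_simps)
qed

lemma small_model_explicit: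
  assumes "a1 * y1 + a2 * y2 + a3 * y3 + a4 * y4 = 0" "y1 \<ge> 0" "y2 \<ge> 0" "y3 \<ge> 0" "y4 \<ge> 0"
    "y1 + y2 + y3 + y4 \<le> q\<^sup>2 * (q + 1)"
    "\<And>d1 d2 d3 d4. variation d1 d2 d3 d4 \<le> 2 * q \<Longrightarrow> y1 * d1 + y2 * d2 + y3 * d3 + y4 * d4 = 0 \<Longrightarrow>
      \<exists>k. d1 = k * a1 \<and> d2 = k * a2 \<and> d3 = k * a3 \<and> d4 = k * a4"
  shows "has_small_model q (int_vec a1 a2 a3 a4)"
  unfolding has_small_model_def
proof (intro bexI conjI ballI impI)
  show "int_vec y1 y2 y3 y4 \<in> annihilator {int_vec a1 a2 a3 a4}"
    using assms(1) by (simp add: annihilator_def inner_vec_vec)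
  show "nonneg_vec (int_vec y1 y2 y3 y4)"
    using assms by (simp add: nonneg_vec_def coords_def int_vec_def)
  show "integral_vec (int_vec y1 y2 y3 y4)" by (rule integral_vec_vec)
  show "gap_sum (int_vec y1 y2 y3 y4) \<le> of_int (q\<^sup>2 * (q + 1))"
    using assms(6) by (simp only: int_vec_def gap_sum.simps of_int_add[symmetric] of_int_le_iff)
  fix c x assume c: "c \<in> relations q" "c \<bullet> int_vec y1 y2 y3 y4 = 0" and x: "x \<in> annihilator {int_vec a1 a2 a3 a4}"
  obtain d1 d2 d3 d4 where d: "c = int_vec d1 d2 d3 d4" "variation d1 d2 d3 d4 \<le> 2 * q"
    using c(1) by (rule relationsE)
  have "d1 * y1 + d2 * y2 + d3 * y3 + d4 * y4 = 0"
    using c(2) unfolding d(1) inner_vec_vec of_int_eq_0_iff .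
  then obtain k where k: "d1 = k * a1" "d2 = k * a2" "d3 = k * a3" "d4 = k * a4"
    using assms(7)[OF d(2)] by (auto simp: mult.commute)
  have "c = of_int k *\<^sub>R int_vec a1 a2 a3 a4" unfolding d(1) k by (simp add: int_vec_def)
  then show "c \<bullet> x = 0" using x by (simp add: annihilator_def)
qed

text \<open>Lifting costs \<open>h * q^2\<close>; for a relation of norm \<open>q\<close> the facet
  point may therefore have size \<open>q^2\<close>.\<close>

lemma small_model_via_facet_point:
  assumes q: "q \<ge> 1" and a: "a \<noteq> 0" "integral_vec a" "mid_bound a (of_int h)"
    and x: "x \<in> annihilator {a}" "pos_vec x" and e: "e \<in> coords"
    and p: "p \<in> annihilator {a}" "nonneg_vec p" "integral_vec p" "e \<bullet> p = 0"
    and gen: "\<And>c x. c \<in> relations q \<Longrightarrow> c \<bullet> p = 0 \<Longrightarrow> x \<in> annihilator {a} \<Longrightarrow> e \<bullet> x = 0 \<Longrightarrow> c \<bullet> x = 0"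
    and tot: "gap_sum p \<le> of_int k" "k + h * q\<^sup>2 \<le> q\<^sup>2 * (q + 1)"
  shows "has_small_model q a"
proof -
  have nx: "nonneg_vec x" "e \<bullet> x > 0" using x e by (auto simp: pos_vec_def nonneg_vec_def intro: less_imp_le)
  have "\<exists>y\<in>annihilator {a}. nonneg_vec y \<and> integral_vec y \<and> gap_sum y \<le> gap_sum p + of_int h * (of_int q)\<^sup>2 \<and>
    (\<forall>c\<in>relations q. c \<bullet> y = 0 \<longrightarrow> (\<forall>x\<in>annihilator {a}. c \<bullet> x = 0))"
    by (rule lift_line_model[where e = e and t = x];
        fact finite_relations coords_relations[OF q] relations_integral relations_mid_bound a e p x nx gen)
  then obtain y where y: "y \<in> annihilator {a}" "nonneg_vec y" "integral_vec y"
    "gap_sum y \<le> gap_sum p + of_int h * (of_int q)\<^sup>2"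
    "\<forall>c\<in>relations q. c \<bullet> y = 0 \<longrightarrow> (\<forall>x\<in>annihilator {a}. c \<bullet> x = 0)"
    by blast
  have "gap_sum y \<le> of_int (k + h * q\<^sup>2)" using y(4) tot(1) by simp
  also have "\<dots> \<le> of_int (q\<^sup>2 * (q + 1))" using tot(2) by (simp only: of_int_le_iff)
  finally show ?thesis unfolding has_small_model_def using y by blast
qed

text \<open>Contracting the gap \<open>e\<close> leaves its coefficient free, so the norm of \<open>a + s e\<close> counts.\<close>

lemma small_model_via_contraction:
  assumes q: "q \<ge> 1" and a: "integral_vec a" "mid_bound a (of_int h)"
    and x: "x \<in> annihilator {a}" "pos_vec x" and e: "e \<in> coords"
    and f: "f \<in> coords" "f \<noteq> e" "f \<bullet> a > 0" and g: "g \<in> coords" "g \<noteq> e" "g \<bullet> a < 0"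
    and s: "mid_bound (a + of_int s *\<^sub>R e) (of_int k)"
    and tot: "k * (1 + q) + h * q\<^sup>2 \<le> q\<^sup>2 * (q + 1)"
  shows "has_small_model q a"
proof -
  \<comment> \<open>On the facet where \<open>e\<close> vanishes \<open>b\<close> agrees with
    \<open>a\<close>, so the relation may be replaced by one of norm \<open>k\<close>.\<close>
  define b where "b = a + of_int s *\<^sub>R e"
  have orth: "u \<bullet> v = (if u = v then 1 else 0)" if "u \<in> coords" "v \<in> coords" for u v
    using that unfolding coords_def by (elim insertE emptyE) simp_all
  have fb: "f \<bullet> b > 0" using f e by (simp add: b_def inner_add_right orth)
  have "b \<notin> span {e}"
  proof
    assume "b \<in> span {e}"
    then obtain c where "b = c *\<^sub>R e" by (auto simp: span_singleton)
    then show False using fb f e by (simp add: orth)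
  qed
  moreover have "e \<noteq> 0" using e by (auto simp: coords_def zero_prod_def)
  ultimately have ind: "independent {b, e}" by (simp add: independent_insert)
  have be: "b \<noteq> e" using \<open>b \<notin> span {e}\<close> by (auto simp: span_base)
  have ib: "integral_vec b" unfolding b_def
    using a(1) coords_simps(2)[OF e] by (cases a; cases e) auto
  have ker: "annihilator {b, e} = {x \<in> annihilator {a}. e \<bullet> x = 0}"
    by (auto simp: annihilator_def b_def inner_add_left)
  \<comment> \<open>A point of the facet that is positive in the other three coordinates: start from
    all ones, where \<open>a\<close> takes the value \<open>S\<close>, and raise the coordinate
    \<open>f\<close> or \<open>g\<close> until \<open>S\<close> is cancelled.\<close>
  define S where "S = (\<Sum>c\<in>coords - {e}. c \<bullet> a)"
  define \<alpha> \<beta> where "\<alpha> = max 0 (- S) / (f \<bullet> a)" and "\<beta> = max 0 S / (- (g \<bullet> a))"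
  have \<alpha>\<beta>: "\<alpha> \<ge> 0" "\<beta> \<ge> 0" using f(3) g(3) by (auto simp: \<alpha>_def \<beta>_def intro!: divide_nonneg_nonneg divide_nonneg_neg)
  define t where "t = (\<Sum>c\<in>coords - {e}. c) + \<alpha> *\<^sub>R f + \<beta> *\<^sub>R g"
  have fin: "finite (coords - {e})" using coords_simps(1) by simp
  have sum1: "u \<bullet> (\<Sum>c\<in>coords - {e}. c) = (if u = e then 0 else 1)" if u: "u \<in> coords" for u
  proof -
    have "u \<bullet> (\<Sum>c\<in>coords - {e}. c) = (\<Sum>c\<in>coords - {e}. if u = c then 1 else 0)"
      unfolding inner_sum_right using u by (intro sum.cong) (auto simp: orth)
    then show ?thesis using fin u by (simp add: sum.delta')
  qed
  have et: "e \<bullet> t = 0" using sum1[OF e] e f g by (simp add: t_def inner_add_right orth)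
  have ut: "u \<bullet> t \<ge> 1" if u: "u \<in> coords" "u \<noteq> e" for u
    using sum1[OF u(1)] u f g \<alpha>\<beta> by (simp add: t_def inner_add_right orth)
  have "a \<bullet> t = S + \<alpha> * (f \<bullet> a) + \<beta> * (g \<bullet> a)"
    unfolding t_def S_def inner_add_right inner_sum_right by (simp add: inner_commute)
  also have "\<dots> = 0" using f(3) g(3) by (simp add: \<alpha>_def \<beta>_def max_def)
  finally have t: "t \<in> annihilator {b, e}" using et unfolding ker by (simp add: annihilator_def)
  have nt: "nonneg_vec t" unfolding nonneg_vec_def using et ut by (metis order_refl order_trans zero_le_one)
  have t0: "t \<noteq> 0" using ut[OF f(1,2)] by auto
  have supp: "u \<bullet> x = 0" if "u \<in> coords" "u \<bullet> t = 0" "x \<in> annihilator {b, e}" for u x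
    using ut[OF that(1)] that unfolding ker by force
  have me: "mid_bound e 1" using coords_simps(3)[OF e] .
  \<comment> \<open>\<open>b\<close> has norm \<open>k\<close> and the coordinate \<open>e\<close>
    has norm 1, whence the size \<open>k * (1 + q)\<close>.\<close>
  have "\<exists>y\<in>annihilator {b, e}. nonneg_vec y \<and> integral_vec y \<and> gap_sum y \<le> of_int k * 1 * (1 + of_int q) \<and>
    (\<forall>c\<in>relations q. c \<bullet> y = 0 \<longrightarrow> (\<forall>x\<in>annihilator {b, e}. c \<bullet> x = 0))"
    by (rule plane_model[where t = t];
        fact finite_relations coords_relations[OF q] relations_integral relations_mid_bound
          ind be ib coords_simps(2)[OF e] s[folded b_def] me t nt t0 supp)
  then obtain p where p: "p \<in> annihilator {b, e}" "nonneg_vec p" "integral_vec p"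
    "gap_sum p \<le> of_int k * 1 * (1 + of_int q)"
    "\<forall>c\<in>relations q. c \<bullet> p = 0 \<longrightarrow> (\<forall>x\<in>annihilator {b, e}. c \<bullet> x = 0)"
    by blast
  have "a \<noteq> 0" using f(3) by auto
  then show ?thesis
  proof (rule small_model_via_facet_point[OF q _ a x e])
    show "c \<bullet> x = 0" if "c \<in> relations q" "c \<bullet> p = 0" "x \<in> annihilator {a}" "e \<bullet> x = 0" for c x
      using p(5) that unfolding ker by blast
    show "gap_sum p \<le> of_int (k * (1 + q))" using p(4) by simp
  qed (use p tot in \<open>auto simp: ker\<close>)
qed

lemma inner_coords:
  "int_vec 1 0 0 0 \<bullet> int_vec a b c d = of_int a" "int_vec 0 1 0 0 \<bullet> int_vec a b c d = of_int b"
  "int_vec 0 0 1 0 \<bullet> int_vec a b c d = of_int c" "int_vec 0 0 0 1 \<bullet> int_vec a b c d = of_int d"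
  by (simp_all add: inner_vec_vec)

lemma vec_eq: "int_vec a b c d = int_vec a' b' c' d' \<longleftrightarrow> a = a' \<and> b = b' \<and> c = c' \<and> d = d'"
  by (simp add: int_vec_def)

lemma vec_add_scale:
  "int_vec a b c d + of_int s *\<^sub>R int_vec a' b' c' d' = int_vec (a + s * a') (b + s * b') (c + s * c') (d + s * d')"
  by (simp add: int_vec_def)

lemma small_model_via_contraction_vec:
  assumes q: "q \<ge> 1" and x: "x \<in> annihilator {int_vec c1 c2 c3 c4}" "pos_vec x"
    and h: "inner_bound c1 c2 c3 c4 h" and tot: "k * (1 + q) + h * q\<^sup>2 \<le> q\<^sup>2 * (q + 1)"
    and c: "mixed3 c2 c3 c4 \<and> inner_bound s c2 c3 c4 k \<or> mixed3 c1 c3 c4 \<and> inner_bound c1 s c3 c4 k \<or>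
      mixed3 c1 c2 c4 \<and> inner_bound c1 c2 s c4 k \<or> mixed3 c1 c2 c3 \<and> inner_bound c1 c2 c3 s k"
  shows "has_small_model q (int_vec c1 c2 c3 c4)"
proof -
  let ?a = "int_vec c1 c2 c3 c4"
  let ?e1 = "int_vec 1 0 0 0" and ?e2 = "int_vec 0 1 0 0" and ?e3 = "int_vec 0 0 1 0" and ?e4 = "int_vec 0 0 0 1"
  have main: "has_small_model q ?a" if e: "e \<in> coords" and fg: "\<exists>f\<in>coords. f \<noteq> e \<and> f \<bullet> ?a > 0" "\<exists>g\<in>coords. g \<noteq> e \<and> g \<bullet> ?a < 0"
    and s: "mid_bound (?a + of_int s *\<^sub>R e) (of_int k)" for e s
    using small_model_via_contraction[OF q integral_vec_vec _ x e _ _ _ _ _ _ s tot] h fg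
    by (auto simp: mid_bound_vec simp del: split_paired_Ex split_paired_All)
  have E: "?e1 \<in> coords" "?e2 \<in> coords" "?e3 \<in> coords" "?e4 \<in> coords" by (simp_all add: coords_vec)
  from c show ?thesis
  proof (elim disjE conjE)
    assume "mixed3 c2 c3 c4" "inner_bound s c2 c3 c4 k"
    then show ?thesis
      by (intro main[of ?e1 "s - c1"])
        (auto simp: mixed3_def coords_vec inner_coords vec_eq vec_add_scale mid_bound_vec simp del: of_int_diff)
  next
    assume "mixed3 c1 c3 c4" "inner_bound c1 s c3 c4 k"
    then show ?thesis
      by (intro main[of ?e2 "s - c2"])
        (auto simp: mixed3_def coords_vec inner_coords vec_eq vec_add_scale mid_bound_vec simp del: of_int_diff)
  next
    assume "mixed3 c1 c2 c4" "inner_bound c1 c2 s c4 k"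
    then show ?thesis
      by (intro main[of ?e3 "s - c3"])
        (auto simp: mixed3_def coords_vec inner_coords vec_eq vec_add_scale mid_bound_vec simp del: of_int_diff)
  next
    assume "mixed3 c1 c2 c3" "inner_bound c1 c2 c3 s k"
    then show ?thesis
      by (intro main[of ?e4 "s - c4"])
        (auto simp: mixed3_def coords_vec inner_coords vec_eq vec_add_scale mid_bound_vec simp del: of_int_diff)
  qed
qed

text \<open>Only \<open>i\<close> and \<open>j\<close> enter the relation, so on the facet where
  \<open>i\<close> vanishes \<open>j\<close> vanishes too. The coordinates \<open>k\<close> and
  \<open>l\<close> remain, subject to no relation.\<close>

lemma small_model_two_free:
  assumes q: "q \<ge> 2" and x: "x \<in> annihilator {a}" "pos_vec x" and a: "a \<noteq> 0" "integral_vec a" "mid_bound a (of_int q)"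
    and d: "coords = {i, j, k, l}" "distinct [i, j, k, l]" and z: "k \<bullet> a = 0" "l \<bullet> a = 0"
  shows "has_small_model q a"
proof -
  have orth: "u \<bullet> v = (if u = v then 1 else 0)" if "u \<in> coords" "v \<in> coords" for u v
    using that unfolding coords_def by (elim insertE emptyE) simp_all
  have mem: "i \<in> coords" "j \<in> coords" "k \<in> coords" "l \<in> coords" unfolding d by auto
  have zero: "v = 0" if "\<And>u. u \<in> coords \<Longrightarrow> u \<bullet> v = 0" for v
    using coord_nonzero that by blast
  have expand: "v \<bullet> w = (\<Sum>u\<in>coords. (u \<bullet> v) * (u \<bullet> w))" for v w
    by (cases v; cases w) (simp add: coords_def)
  have expand4: "v \<bullet> w = (i \<bullet> v) * (i \<bullet> w) + (j \<bullet> v) * (j \<bullet> w) + (k \<bullet> v) * (k \<bullet> w) + (l \<bullet> v) * (l \<bullet> w)" for v w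
    unfolding expand[of v w] d(1) using d(2) by simp
  \<comment> \<open>(1, q) is generic in the two free coordinates: a relation vanishing there has
    coefficients \<open>- q * m\<close> and \<open>m\<close>, whose difference exceeds
    \<open>q\<close> in absolute value unless \<open>m = 0\<close>.\<close>
  define p where "p = k + of_int q *\<^sub>R l"
  have ip: "i \<bullet> p = 0" "j \<bullet> p = 0" "k \<bullet> p = 1" "l \<bullet> p = of_int q"
    using mem d(2) by (auto simp: p_def inner_add_right orth)
  have xpos: "i \<bullet> x > 0" "j \<bullet> x > 0" using x(2) mem by (auto simp: pos_vec_def)
  have ax: "(i \<bullet> a) * (i \<bullet> x) + (j \<bullet> a) * (j \<bullet> x) = 0"
    using x(1) z expand4[of a x] by (simp add: annihilator_def)
  have ja: "j \<bullet> a \<noteq> 0"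
  proof
    assume 0: "j \<bullet> a = 0"
    then have "i \<bullet> a = 0" using ax xpos by simp
    then have "u \<bullet> a = 0" if "u \<in> coords" for u using that 0 z unfolding d(1) by auto
    then show False using a(1) zero by blast
  qed
  have bound: "\<bar>u \<bullet> c - v \<bullet> c\<bar> \<le> of_int q" if cuv: "c \<in> relations q" "u \<in> coords" "v \<in> coords" for c u v
  proof -
    obtain c1 c2 c3 c4 where c: "c = int_vec c1 c2 c3 c4" "variation c1 c2 c3 c4 \<le> 2 * q"
      using cuv(1) by (rule relationsE)
    then have "inner_bound c1 c2 c3 c4 q" "q \<ge> 0" using inner_bound_variation q by auto
    then show ?thesis
      using cuv(2,3) unfolding coords_vec c(1) inner_bound_def
      by (elim insertE emptyE; simp only: inner_coords of_int_diff[symmetric] of_int_abs[symmetric] of_int_le_iff)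
        (simp_all add: abs_minus_commute)
  qed
  show ?thesis
  proof (rule small_model_via_facet_point[where p = p and k = "1 + q", OF _ a x mem(1)])
    show "q \<ge> 1" using q by simp
    show "p \<in> annihilator {a}" using expand4[of a p] ip z by (simp add: annihilator_def)
    show "nonneg_vec p" using ip q unfolding nonneg_vec_def d(1) by auto
    show "integral_vec p" unfolding p_def using coords_simps(2)[OF mem(3)] coords_simps(2)[OF mem(4)]
      by (cases k; cases l) auto
    show "i \<bullet> p = 0" by (rule ip)
    have tc: "gap_sum u = 1" if "u \<in> coords" for u using that by (auto simp: coords_def)
    show "gap_sum p \<le> of_int (1 + q)" by (simp add: p_def gap_sum_simps tc mem)
    show "1 + q + q * q\<^sup>2 \<le> q\<^sup>2 * (q + 1)"
    proof -
      have "2 * q \<le> q * q" by (rule mult_right_mono) (use q in auto)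
      then have "1 + q \<le> q * q" using q by linarith
      then show ?thesis by (simp add: power2_eq_square algebra_simps)
    qed
    show "c \<bullet> y = 0" if c: "c \<in> relations q" "c \<bullet> p = 0" and y: "y \<in> annihilator {a}" "i \<bullet> y = 0" for c y
    proof -
      obtain c1 c2 c3 c4 where "c = int_vec c1 c2 c3 c4" using c(1) by (rule relationsE)
      then have "u \<bullet> c \<in> \<int>" if "u \<in> coords" for u
        using that unfolding coords_vec by (auto simp: inner_coords)
      then obtain m where m: "l \<bullet> c = of_int m" using mem(4) by (metis Ints_cases)
      have "k \<bullet> c + of_int m * of_int q = 0" using c(2) expand4[of c p] ip m by simp
      then have kc: "k \<bullet> c = - of_int q * of_int m" by (simp add: algebra_simps)
      have "\<bar>(q + 1) * m\<bar> \<le> q"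
      proof -
        have "real_of_int \<bar>(q + 1) * m\<bar> = \<bar>k \<bullet> c - l \<bullet> c\<bar>" unfolding kc m by (simp add: algebra_simps)
        also have "\<dots> \<le> of_int q" by (rule bound[OF c(1) mem(3,4)])
        finally show ?thesis by linarith
      qed
      then have "m = 0"
        using small_multiple[of "q + 1" m "(q + 1) * m" 0] q by simp
      then have kl: "k \<bullet> c = 0" "l \<bullet> c = 0" using kc m by simp_all
      have "(j \<bullet> a) * (j \<bullet> y) = 0" using y expand4[of a y] z by (simp add: annihilator_def)
      then have "j \<bullet> y = 0" using ja by simp
      then show ?thesis using expand4[of c y] kl y by simp
    qed
  qed
qed

lemma annihilator_vec: "(x1, x2, x3, x4) \<in> annihilator {int_vec a b c d} \<longleftrightarrow> a * x1 + b * x2 + c * x3 + d * x4 = 0"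
  by (simp add: annihilator_def inner_vec)

lemma pos_vec_simp: "pos_vec (x1, x2, x3, x4) \<longleftrightarrow> x1 > 0 \<and> x2 > 0 \<and> x3 > 0 \<and> x4 > 0"
  by (simp add: pos_vec_def coords_def)

lemma nonneg_vec_vec: "nonneg_vec (int_vec a b c d) \<longleftrightarrow> a \<ge> 0 \<and> b \<ge> 0 \<and> c \<ge> 0 \<and> d \<ge> 0"
  by (simp add: nonneg_vec_def coords_def int_vec_def)

lemma gap_sum_vec: "gap_sum (int_vec a b c d) = of_int (a + b + c + d)"
  by (simp add: int_vec_def)

lemma annihilator_vec_vec: "int_vec x y z w \<in> annihilator {int_vec a b c d} \<longleftrightarrow> a * x + b * y + c * z + d * w = 0"
  unfolding annihilator_def inner_vec_vec mem_Collect_eq ball_simps of_int_eq_0_iff by simp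

text \<open>Contracting the gap whose coefficient \<open>c\<close> leaves open reduces the relation
  to (r, r, -p). The point of \<open>generic_facet_rrp\<close> has size \<open>q^2\<close>, exactly
  the budget beside a lift of size \<open>q * q^2\<close>.\<close>

lemma small_model_rrp:
  assumes p: "p \<ge> 2" "r \<ge> 1" "q = p + r" and x: "x \<in> annihilator {int_vec c1 c2 c3 c4}" "pos_vec x"
    and h: "inner_bound c1 c2 c3 c4 q"
    and c: "c1 = r \<and> c2 = r \<and> c3 = - p \<or> c1 = r \<and> c2 = r \<and> c4 = - p \<or> c2 = r \<and> c3 = r \<and> c4 = - p"
  shows "has_small_model q (int_vec c1 c2 c3 c4)"
proof -
  let ?a = "int_vec c1 c2 c3 c4"
  have q: "q \<ge> 1" and pq: "p * q - 1 \<ge> 0" using p mult_mono[of 1 p 1 q] by auto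
  have tot: "q\<^sup>2 + q * q\<^sup>2 \<le> q\<^sup>2 * (q + 1)" by (simp add: algebra_simps)
  have sum: "1 + (p * q - 1) + r * q = q\<^sup>2" using p by (simp add: power2_eq_square algebra_simps)
  have a0: "?a \<noteq> 0" using c p by (auto simp: int_vec_def zero_prod_def)
  have E: "int_vec 1 0 0 0 \<in> coords" "int_vec 0 0 1 0 \<in> coords" "int_vec 0 0 0 1 \<in> coords" by (simp_all add: coords_vec)
  have ma: "mid_bound ?a (of_int q)" using h by (simp add: mid_bound_vec)
  have fin: "\<alpha> * x1 + \<beta> * x2 + \<gamma> * x3 = 0"
    if "of_int r * x1 + of_int r * x2 - of_int p * x3 = 0" "\<alpha> = \<beta> \<and> p * \<alpha> + r * \<gamma> = 0" for x1 x2 x3 :: real and \<alpha> \<beta> \<gamma> :: int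
  proof -
    have "p * \<alpha> = - (r * \<gamma>)" using that(2) by linarith
    then have "real_of_int (p * \<alpha>) = real_of_int (- (r * \<gamma>))" by (simp only:)
    then have e: "real_of_int r * of_int \<gamma> = - (of_int p * of_int \<alpha>)" by simp
    \<comment> \<open>Multiplying by the nonzero \<open>r\<close> avoids a division: the result is
      \<open>\<alpha>\<close> times the relation.\<close>
    have "of_int r * (\<alpha> * x1 + \<alpha> * x2 + \<gamma> * x3) = \<alpha> * (of_int r * x1 + of_int r * x2) + (of_int r * of_int \<gamma>) * x3"
      by (simp add: algebra_simps)
    also have "\<dots> = \<alpha> * (of_int p * x3) - (of_int p * of_int \<alpha>) * x3"
      unfolding e using that(1) by simp
    finally have "of_int r * (\<alpha> * x1 + \<alpha> * x2 + \<gamma> * x3) = 0" by (simp add: algebra_simps)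
    then show ?thesis using p(2) that(2) by simp
  qed
  have dvec: "\<exists>d1 d2 d3 d4. c = int_vec d1 d2 d3 d4 \<and> variation d1 d2 d3 d4 \<le> 2 * q" if "c \<in> relations q" for c
    using that by (auto simp: relations_def)
  from c consider "c1 = r" "c2 = r" "c3 = - p" | "c1 = r" "c2 = r" "c4 = - p" | "c2 = r" "c3 = r" "c4 = - p" by blast
  then show ?thesis
  proof cases
    case 1
    show ?thesis
    proof (rule small_model_via_facet_point[where e = "int_vec 0 0 0 1" and p = "int_vec 1 (p * q - 1) (r * q) 0" and k = "q\<^sup>2" and h = q and x = x])
      fix c y assume c: "c \<in> relations q" "c \<bullet> int_vec 1 (p * q - 1) (r * q) 0 = 0" and y: "y \<in> annihilator {?a}" "int_vec 0 0 0 1 \<bullet> y = 0"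
      obtain d1 d2 d3 d4 where d: "c = int_vec d1 d2 d3 d4" "variation d1 d2 d3 d4 \<le> 2 * q" using dvec[OF c(1)] by blast
      \<comment> \<open>Dropping a term from a sequence does not increase its variation.\<close>
      have "\<bar>d1\<bar> + \<bar>d1 - d2\<bar> + \<bar>d2 - d3\<bar> + \<bar>d3\<bar> \<le> 2 * q" using d(2) unfolding variation_def by linarith
      moreover have "d1 + (p * q - 1) * d2 + r * q * d3 = 0"
        using c(2) unfolding d(1) inner_vec_vec of_int_eq_0_iff by (simp add: mult.commute)
      ultimately have f: "d1 = d2 \<and> p * d1 + r * d3 = 0" by (rule generic_facet_rrp[OF p])
      obtain x1 x2 x3 x4 where yy: "y = (x1, x2, x3, x4)" by (cases y)
      have "x4 = 0" using y(2) by (simp add: yy inner_vec)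
      then show "c \<bullet> y = 0" using fin[OF _ f, of x1 x2 x3] y(1) 1
        by (simp add: yy d(1) inner_vec annihilator_vec)
    next
      show "int_vec 0 0 0 1 \<bullet> int_vec 1 (p * q - 1) (r * q) 0 = 0" by (simp add: inner_vec_vec)
      show "1 \<le> q" "?a \<noteq> 0" "mid_bound ?a (of_int q)" "x \<in> annihilator {?a}" "pos_vec x" by fact+
      show "q\<^sup>2 + q * q\<^sup>2 \<le> q\<^sup>2 * (q + 1)" by (rule tot)
    qed (use pq p sum E in \<open>simp_all add: gap_sum_vec nonneg_vec_vec annihilator_vec_vec 1 integral_vec_vec algebra_simps
        del: of_int_add of_int_mult of_int_diff of_int_power\<close>)
  next
    case 2
    show ?thesis
    proof (rule small_model_via_facet_point[where e = "int_vec 0 0 1 0" and p = "int_vec 1 (p * q - 1) 0 (r * q)" and k = "q\<^sup>2" and h = q and x = x])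
      fix c y assume c: "c \<in> relations q" "c \<bullet> int_vec 1 (p * q - 1) 0 (r * q) = 0" and y: "y \<in> annihilator {?a}" "int_vec 0 0 1 0 \<bullet> y = 0"
      obtain d1 d2 d3 d4 where d: "c = int_vec d1 d2 d3 d4" "variation d1 d2 d3 d4 \<le> 2 * q" using dvec[OF c(1)] by blast
      have "\<bar>d1\<bar> + \<bar>d1 - d2\<bar> + \<bar>d2 - d4\<bar> + \<bar>d4\<bar> \<le> 2 * q" using d(2) unfolding variation_def by linarith
      moreover have "d1 + (p * q - 1) * d2 + r * q * d4 = 0"
        using c(2) unfolding d(1) inner_vec_vec of_int_eq_0_iff by (simp add: mult.commute)
      ultimately have f: "d1 = d2 \<and> p * d1 + r * d4 = 0" by (rule generic_facet_rrp[OF p])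
      obtain x1 x2 x3 x4 where yy: "y = (x1, x2, x3, x4)" by (cases y)
      have "x3 = 0" using y(2) by (simp add: yy inner_vec)
      then show "c \<bullet> y = 0" using fin[OF _ f, of x1 x2 x4] y(1) 2
        by (simp add: yy d(1) inner_vec annihilator_vec)
    next
      show "int_vec 0 0 1 0 \<bullet> int_vec 1 (p * q - 1) 0 (r * q) = 0" by (simp add: inner_vec_vec)
      show "1 \<le> q" "?a \<noteq> 0" "mid_bound ?a (of_int q)" "x \<in> annihilator {?a}" "pos_vec x" by fact+
      show "q\<^sup>2 + q * q\<^sup>2 \<le> q\<^sup>2 * (q + 1)" by (rule tot)
    qed (use pq p sum E in \<open>simp_all add: gap_sum_vec nonneg_vec_vec annihilator_vec_vec 2 integral_vec_vec algebra_simps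
        del: of_int_add of_int_mult of_int_diff of_int_power\<close>)
  next
    case 3
    show ?thesis
    proof (rule small_model_via_facet_point[where e = "int_vec 1 0 0 0" and p = "int_vec 0 1 (p * q - 1) (r * q)" and k = "q\<^sup>2" and h = q and x = x])
      fix c y assume c: "c \<in> relations q" "c \<bullet> int_vec 0 1 (p * q - 1) (r * q) = 0" and y: "y \<in> annihilator {?a}" "int_vec 1 0 0 0 \<bullet> y = 0"
      obtain d1 d2 d3 d4 where d: "c = int_vec d1 d2 d3 d4" "variation d1 d2 d3 d4 \<le> 2 * q" using dvec[OF c(1)] by blast
      have "\<bar>d2\<bar> + \<bar>d2 - d3\<bar> + \<bar>d3 - d4\<bar> + \<bar>d4\<bar> \<le> 2 * q" using d(2) unfolding variation_def by linarith
      moreover have "d2 + (p * q - 1) * d3 + r * q * d4 = 0"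
        using c(2) unfolding d(1) inner_vec_vec of_int_eq_0_iff by (simp add: mult.commute)
      ultimately have f: "d2 = d3 \<and> p * d2 + r * d4 = 0" by (rule generic_facet_rrp[OF p])
      obtain x1 x2 x3 x4 where yy: "y = (x1, x2, x3, x4)" by (cases y)
      have "x1 = 0" using y(2) by (simp add: yy inner_vec)
      then show "c \<bullet> y = 0" using fin[OF _ f, of x2 x3 x4] y(1) 3
        by (simp add: yy d(1) inner_vec annihilator_vec)
    next
      show "int_vec 1 0 0 0 \<bullet> int_vec 0 1 (p * q - 1) (r * q) = 0" by (simp add: inner_vec_vec)
      show "1 \<le> q" "?a \<noteq> 0" "mid_bound ?a (of_int q)" "x \<in> annihilator {?a}" "pos_vec x" by fact+
      show "q\<^sup>2 + q * q\<^sup>2 \<le> q\<^sup>2 * (q + 1)" by (rule tot)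
    qed (use pq p sum E in \<open>simp_all add: gap_sum_vec nonneg_vec_vec annihilator_vec_vec 3 integral_vec_vec algebra_simps
        del: of_int_add of_int_mult of_int_diff of_int_power\<close>)
  qed
qed

section \<open>Alphabets with one relation\<close>

text \<open>\<open>inner_bound\<close> depends only on differences of coefficients, so
  \<open>d\<close> may be subtracted from all of them. When the two end coefficients share a sign,
  this lowers the variation by at least 2.\<close>

lemma inner_bound_ends:
  assumes V: "variation a b c d \<le> 2 * q" and s: "a > 0 \<and> d > 0 \<or> a < 0 \<and> d < 0"
  shows "inner_bound a b c d (q - 1)"
proof -
  have "\<bar>a\<bar> \<ge> 1" "\<bar>d\<bar> \<ge> 1" "\<bar>a - d\<bar> \<le> \<bar>a\<bar> + \<bar>d\<bar> - 2" using s by auto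
  then have "variation (a - d) (b - d) (c - d) 0 \<le> 2 * (q - 1)"
    using V unfolding variation_def by simp
  then show ?thesis using inner_bound_variation by (fastforce simp: inner_bound_def)
qed

lemma inner_bound_minus: "inner_bound (- a) (- b) (- c) (- d) k = inner_bound a b c d k"
  unfolding inner_bound_def
  by (simp only: minus_diff_minus minus_add_distrib[symmetric] abs_minus_cancel)

text \<open>Each family contains r, r, -p with p + r = q, in this order, among its coefficients. For
  p at least 2 \<open>small_model_rrp\<close> applies; for p = 1 the explicit generic points are
  used, whose size is checked directly.\<close>

lemma small_model_special:
  assumes q: "q \<ge> 2" and sp: "special c1 c2 c3 c4" and V: "variation c1 c2 c3 c4 = 2 * q"
    and x: "x \<in> annihilator {int_vec c1 c2 c3 c4}" "pos_vec x"
  shows "has_small_model q (int_vec c1 c2 c3 c4)"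
proof -
  have h: "inner_bound c1 c2 c3 c4 q" using V by (intro inner_bound_variation) simp
  define Q R where "Q = q * q" and "R = q * q * q"
  have Q: "q\<^sup>2 = Q" "q ^ 3 = R" "Q * (q + 1) = R + Q"
    by (simp_all add: Q_def R_def power2_eq_square power3_eq_cube algebra_simps)
  have "2 * q \<le> q * q" by (rule mult_right_mono) (use q in auto)
  moreover have "(2 * q) * q \<le> (q * q) * q" using calculation by (rule mult_right_mono) (use q in auto)
  ultimately have QR: "2 * q \<le> Q" "2 * Q \<le> R" by (simp_all only: Q_def R_def mult.assoc)
  from sp consider
      (A) "c1 = c2" "c1 > 0" "c3 < 0" "c4 = 0" | (B) "c1 = c2" "0 \<le> c3" "c3 \<le> c1" "c1 > 0" "c4 < 0"
    | (C) "c2 = c3" "0 \<le> c1" "c1 < c2" "c4 < 0" | (D) "c1 = c2" "c1 > 0" "c3 = c4" "c4 < 0" "c1 \<le> - c4"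
    unfolding special_def by blast
  then show ?thesis
  proof cases
    case A
    then have V': "c1 - c3 = q" using V by (simp add: variation_def)
    show ?thesis
    proof (cases "c3 = -1")
      case False
      then show ?thesis using A V' by (intro small_model_rrp[of "- c3" c1 q x]) (use x h in auto)
    next
      case True
      then have e: "c1 = q - 1" "c2 = q - 1" "c3 = - 1" "c4 = 0" using A V' by auto
      show ?thesis unfolding e
      proof (rule small_model_explicit[where ?y1.0 = q and ?y2.0 = 1 and ?y3.0 = "q\<^sup>2 - 1" and ?y4.0 = "q ^ 3 - q - 1"])
        show "\<exists>k. d1 = k * (q - 1) \<and> d2 = k * (q - 1) \<and> d3 = k * - 1 \<and> d4 = k * 0"
          if "variation d1 d2 d3 d4 \<le> 2 * q" "q * d1 + 1 * d2 + (q\<^sup>2 - 1) * d3 + (q ^ 3 - q - 1) * d4 = 0" for d1 d2 d3 d4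
          using generic_rr10[OF q that(1) that(2)[unfolded mult_1_left]] by (intro exI[of _ "- d3"]) (auto simp: left_diff_distrib right_diff_distrib)
      qed ((simp add: power2_eq_square power3_eq_cube algebra_simps; fail) | ((unfold Q)?, use q QR  in linarith))+
    qed
  next
    case B
    then have V': "c1 - c4 = q" using V by (simp add: variation_def)
    show ?thesis
    proof (cases "c4 = -1")
      case False
      then show ?thesis using B V' by (intro small_model_rrp[of "- c4" c1 q x]) (use x h in auto)
    next
      case True
      then have e: "c1 = q - 1" "c2 = q - 1" "c4 = - 1" using B V' by auto
      have s: "0 \<le> c3" "c3 \<le> q - 1" using B e by auto
      have qs: "q * c3 \<le> Q - q" "0 \<le> q * c3"
        using mult_left_mono[OF s(2), of q] s q by (simp_all add: Q_def algebra_simps)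
      show ?thesis unfolding e
      proof (rule small_model_explicit[where ?y1.0 = 1 and ?y2.0 = "q\<^sup>2 - 1" and ?y3.0 = q and ?y4.0 = "q ^ 3 - q\<^sup>2 + q * c3"])
        show "\<exists>k. d1 = k * (q - 1) \<and> d2 = k * (q - 1) \<and> d3 = k * c3 \<and> d4 = k * - 1"
          if "variation d1 d2 d3 d4 \<le> 2 * q" "1 * d1 + (q\<^sup>2 - 1) * d2 + q * d3 + (q ^ 3 - q\<^sup>2 + q * c3) * d4 = 0" for d1 d2 d3 d4
          using generic_rrs1[OF q s that(1) that(2)[unfolded mult_1_left]] by (intro exI[of _ "- d4"]) (auto simp: left_diff_distrib right_diff_distrib)
      qed ((simp add: power2_eq_square power3_eq_cube algebra_simps; fail) | ((unfold Q)?, use q QR qs in linarith))+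
    qed
  next
    case C
    then have V': "c2 - c4 = q" using V by (simp add: variation_def)
    show ?thesis
    proof (cases "c4 = -1")
      case False
      then show ?thesis using C V' by (intro small_model_rrp[of "- c4" c2 q x]) (use x h in auto)
    next
      case True
      then have e: "c2 = q - 1" "c3 = q - 1" "c4 = - 1" using C V' by auto
      show ?thesis
      proof (cases "c1 = 0")
        case c1: True
        show ?thesis unfolding e c1
        proof (rule small_model_explicit[where ?y1.0 = "q ^ 3 - q - 1" and ?y2.0 = q and ?y3.0 = 1 and ?y4.0 = "q\<^sup>2 - 1"])
          show "\<exists>k. d1 = k * 0 \<and> d2 = k * (q - 1) \<and> d3 = k * (q - 1) \<and> d4 = k * - 1"
            if "variation d1 d2 d3 d4 \<le> 2 * q" "(q ^ 3 - q - 1) * d1 + q * d2 + 1 * d3 + (q\<^sup>2 - 1) * d4 = 0" for d1 d2 d3 d4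
            using generic_0rr1[OF q that(1) that(2)[unfolded mult_1_left]] by (intro exI[of _ "- d4"]) (auto simp: left_diff_distrib right_diff_distrib)
        qed ((simp add: power2_eq_square power3_eq_cube algebra_simps; fail) | ((unfold Q)?, use q QR  in linarith))+
      next
        case False
        define m where "m = q - 1 - c1"
        have m: "0 \<le> m" "m \<le> q - 2" and c1: "c1 = q - 1 - m" using C False e by (auto simp: m_def)
        have qm: "q * m \<le> Q - 2 * q" "0 \<le> q * m"
          using mult_left_mono[OF m(2), of q] m q by (simp_all add: Q_def algebra_simps)
        show ?thesis unfolding e c1
        proof (rule small_model_explicit[where ?y1.0 = q and ?y2.0 = "q + 1" and ?y3.0 = "q\<^sup>2 - q - 1" and ?y4.0 = "q ^ 3 - q - q * m"])
          show "\<exists>k. d1 = k * (q - 1 - m) \<and> d2 = k * (q - 1) \<and> d3 = k * (q - 1) \<and> d4 = k * - 1"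
            if "variation d1 d2 d3 d4 \<le> 2 * q" "q * d1 + (q + 1) * d2 + (q\<^sup>2 - q - 1) * d3 + (q ^ 3 - q - q * m) * d4 = 0" for d1 d2 d3 d4
            using generic_srr1[OF q m that] by (intro exI[of _ "- d4"]) (auto simp: left_diff_distrib right_diff_distrib)
        qed ((simp add: power2_eq_square power3_eq_cube algebra_simps; fail) | ((unfold Q)?, use q QR qm in linarith))+
      qed
    qed
  next
    case D
    then have V': "c1 - c3 = q" using V by (simp add: variation_def)
    show ?thesis
    proof (cases "c3 = -1")
      case False
      then show ?thesis using D V' by (intro small_model_rrp[of "- c3" c1 q x]) (use x h in auto)
    next
      case True
      \<comment> \<open>\<open>c1 \<le> - c4\<close> and \<open>c4 = -1\<close> leave only
        \<open>c1 = 1\<close>, hence \<open>q = 2\<close>.\<close>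
      then have e: "c1 = 1" "c2 = 1" "c3 = - 1" "c4 = - 1" and q2: "q = 2" using D V' by auto
      show ?thesis unfolding e q2
      proof (rule small_model_explicit[where ?y1.0 = 1 and ?y2.0 = 4 and ?y3.0 = 2 and ?y4.0 = 3])
        show "\<exists>k. d1 = k * 1 \<and> d2 = k * 1 \<and> d3 = k * - 1 \<and> d4 = k * - 1"
          if "variation d1 d2 d3 d4 \<le> 2 * 2" "1 * d1 + 4 * d2 + 2 * d3 + 3 * d4 = 0" for d1 d2 d3 d4
          using generic_1111[of d1 d2 d3 d4] that by auto
      qed simp_all
    qed
  qed
qed

text \<open>The norm \<open>q\<close> leaves \<open>q^2\<close> for a facet point. Contracting a
  strict extremum costs \<open>(q - 1) * (q + 1)\<close>, two zero coefficients cost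
  \<open>q + 1\<close>, and all other relations are special.\<close>

lemma small_model_relation_oriented:
  assumes q: "q \<ge> 2" and V: "variation c1 c2 c3 c4 \<le> 2 * q" and sg: "c1 \<ge> 0" "c4 \<le> 0"
    and mixed: "c1 > 0 \<or> c2 > 0 \<or> c3 > 0" "c2 < 0 \<or> c3 < 0 \<or> c4 < 0"
    and nb: "\<not> inner_bound c1 c2 c3 c4 (q - 1)"
    and x: "x \<in> annihilator {int_vec c1 c2 c3 c4}" "pos_vec x"
  shows "has_small_model q (int_vec c1 c2 c3 c4)"
proof -
  \<comment> \<open>The variation is even because the sequence starts and ends at 0, so failing the
    bound \<open>q - 1\<close> forces the value \<open>2 * q\<close>.\<close>
  have V2: "variation c1 c2 c3 c4 = 2 * q"
  proof -
    have "\<not> variation c1 c2 c3 c4 \<le> 2 * (q - 1)" using nb inner_bound_variation by blast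
    moreover have "even (variation c1 c2 c3 c4)" unfolding variation_def by (simp add: abs_if; presburger)
    ultimately show ?thesis using V by presburger
  qed
  have h: "inner_bound c1 c2 c3 c4 q" using V by (rule inner_bound_variation)
  have q1: "q \<ge> 1" using q by simp
  have tot: "(q - 1) * (1 + q) + q * q\<^sup>2 \<le> q\<^sup>2 * (q + 1)" by (simp add: algebra_simps power2_eq_square)
  note contr = small_model_via_contraction_vec[OF q1 x h tot]
  have a0: "int_vec c1 c2 c3 c4 \<noteq> 0" using mixed by (auto simp: int_vec_def zero_prod_def)
  have ma: "mid_bound (int_vec c1 c2 c3 c4) (of_int q)" using h by (simp add: mid_bound_vec)
  let ?e1 = "int_vec 1 0 0 0" and ?e2 = "int_vec 0 1 0 0" and ?e3 = "int_vec 0 0 1 0" and ?e4 = "int_vec 0 0 0 1"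
  note two = small_model_two_free[OF q x a0 integral_vec_vec ma]
  consider (peaks) "peak 0 c1 c2 \<and> mixed3 c2 c3 c4 \<or> peak c1 c2 c3 \<and> mixed3 c1 c3 c4 \<or>
      peak c2 c3 c4 \<and> mixed3 c1 c2 c4 \<or> peak c3 c4 0 \<and> mixed3 c1 c2 c3"
    | (zeros) "c1 = 0 \<and> c2 = 0 \<or> c1 = 0 \<and> c3 = 0 \<or> c1 = 0 \<and> c4 = 0 \<or> c2 = 0 \<and> c3 = 0 \<or> c2 = 0 \<and> c4 = 0 \<or> c3 = 0 \<and> c4 = 0"
    | (special) "special c1 c2 c3 c4 \<or> special (-c4) (-c3) (-c2) (-c1)"
    using special_relations[OF sg mixed] by blast
  then show ?thesis
  proof cases
    case peaks
    \<comment> \<open>Replacing a strict extremum by one of its neighbours lowers the variation by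
      at least 2, so the contracted relation has norm at most \<open>q - 1\<close>.\<close>
    have drop: "\<bar>a - c\<bar> + 2 \<le> \<bar>a - b\<bar> + \<bar>b - c\<bar>" if "peak a b c" for a b c
      using that unfolding peak_def by linarith
    have "inner_bound 0 c2 c3 c4 (q - 1)" if "peak 0 c1 c2"
      using drop[OF that] V by (intro inner_bound_variation) (simp add: variation_def)
    moreover have "inner_bound c1 c1 c3 c4 (q - 1)" if "peak c1 c2 c3"
      using drop[OF that] V by (intro inner_bound_variation) (simp add: variation_def)
    moreover have "inner_bound c1 c2 c2 c4 (q - 1)" if "peak c2 c3 c4"
      using drop[OF that] V by (intro inner_bound_variation) (simp add: variation_def)
    moreover have "inner_bound c1 c2 c3 c3 (q - 1)" if "peak c3 c4 0"
      using drop[OF that] V by (intro inner_bound_variation) (simp add: variation_def)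
    ultimately show ?thesis using peaks contr by blast
  next
    case zeros
    have z: "coords = {?e3, ?e4, ?e1, ?e2}" "coords = {?e2, ?e4, ?e1, ?e3}" "coords = {?e2, ?e3, ?e1, ?e4}"
      "coords = {?e1, ?e4, ?e2, ?e3}" "coords = {?e1, ?e3, ?e2, ?e4}" "coords = {?e1, ?e2, ?e3, ?e4}"
      unfolding coords_vec by blast+
    from zeros show ?thesis
    proof (elim disjE conjE)
      assume "c1 = 0" "c2 = 0" then show ?thesis by (intro two[OF z(1)]) (simp_all add: vec_eq inner_coords)
    next
      assume "c1 = 0" "c3 = 0" then show ?thesis by (intro two[OF z(2)]) (simp_all add: vec_eq inner_coords)
    next
      assume "c1 = 0" "c4 = 0" then show ?thesis by (intro two[OF z(3)]) (simp_all add: vec_eq inner_coords)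
    next
      assume "c2 = 0" "c3 = 0" then show ?thesis by (intro two[OF z(4)]) (simp_all add: vec_eq inner_coords)
    next
      assume "c2 = 0" "c4 = 0" then show ?thesis by (intro two[OF z(5)]) (simp_all add: vec_eq inner_coords)
    next
      assume "c3 = 0" "c4 = 0" then show ?thesis by (intro two[OF z(6)]) (simp_all add: vec_eq inner_coords)
    qed
  next
    case special
    then show ?thesis
    proof
      assume "special c1 c2 c3 c4"
      then show ?thesis using small_model_special q V2 x by blast
    next
      assume sp: "special (-c4) (-c3) (-c2) (-c1)"
      have "variation (-c4) (-c3) (-c2) (-c1) = 2 * q" using V2 by (simp add: variation_def)
      moreover have "rev_vec x \<in> annihilator {int_vec (-c4) (-c3) (-c2) (-c1)}"
        using x(1) by (cases x) (simp add: annihilator_vec)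
      moreover have "pos_vec (rev_vec x)" using x(2) by (simp add: rev_vec_simps)
      ultimately have "has_small_model q (int_vec (-c4) (-c3) (-c2) (-c1))" using small_model_special q sp by blast
      moreover have "int_vec (-c4) (-c3) (-c2) (-c1) = - rev_vec (int_vec c1 c2 c3 c4)" by (simp add: int_vec_def)
      ultimately show ?thesis using small_model_uminus small_model_rev by metis
    qed
  qed
qed

text \<open>A positive point on the relation forces coefficients of both signs. Norm at most
  \<open>q - 1\<close> is settled by a contraction; otherwise \<open>inner_bound_ends\<close>
  excludes end coefficients of equal sign, and negation reaches the oriented case.\<close>

lemma small_model_relation:
  assumes q: "q \<ge> 2" and a: "a \<in> relations q" "a \<noteq> 0" and x: "x \<in> annihilator {a}" "pos_vec x"
  shows "has_small_model q a"
proof -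
  obtain c1 c2 c3 c4 where c: "a = int_vec c1 c2 c3 c4" and V: "variation c1 c2 c3 c4 \<le> 2 * q"
    using a(1) by (rule relationsE)
  obtain x1 x2 x3 x4 where xx: "x = (x1, x2, x3, x4)" by (cases x)
  have pos: "x1 > 0" "x2 > 0" "x3 > 0" "x4 > 0" using x(2) by (simp_all add: xx pos_vec_simp)
  have ker: "c1 * x1 + c2 * x2 + c3 * x3 + c4 * x4 = 0" using x(1) by (simp add: xx c annihilator_vec)
  have nz: "c1 \<noteq> 0 \<or> c2 \<noteq> 0 \<or> c3 \<noteq> 0 \<or> c4 \<noteq> 0" using a(2) by (auto simp: c int_vec_def zero_prod_def)
  have key: "\<exists>c\<in>{d1, d2, d3, d4}. c > 0"
    if d: "d1 * x1 + d2 * x2 + d3 * x3 + d4 * x4 = 0" "d1 \<noteq> 0 \<or> d2 \<noteq> 0 \<or> d3 \<noteq> 0 \<or> d4 \<noteq> 0" for d1 d2 d3 d4 :: int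
  proof (rule ccontr)
    assume "\<not> ?thesis"
    then have "d1 \<le> 0" "d2 \<le> 0" "d3 \<le> 0" "d4 \<le> 0" by auto
    then have "d1 * x1 \<le> 0" "d2 * x2 \<le> 0" "d3 * x3 \<le> 0" "d4 * x4 \<le> 0"
      using pos by (simp_all add: mult_nonpos_nonneg)
    then have "d1 * x1 = 0" "d2 * x2 = 0" "d3 * x3 = 0" "d4 * x4 = 0" using d(1) by linarith+
    then show False using pos d(2) by auto
  qed
  have P: "c1 > 0 \<or> c2 > 0 \<or> c3 > 0 \<or> c4 > 0" using key[OF ker nz] by auto
  have N: "c1 < 0 \<or> c2 < 0 \<or> c3 < 0 \<or> c4 < 0"
    using key[of "-c1" "-c2" "-c3" "-c4"] ker nz by auto
  show ?thesis
  proof (cases "inner_bound c1 c2 c3 c4 (q - 1)")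
    case True
    \<comment> \<open>Lifting costs only \<open>(q - 1) * q^2\<close>, so the contracted relation
      may have norm \<open>q\<close>.\<close>
    have "q * (1 + q) + (q - 1) * q\<^sup>2 \<le> q\<^sup>2 * (q + 1)"
    proof -
      have "1 * q \<le> q * q" by (rule mult_right_mono) (use q in auto)
      then show ?thesis by (simp add: algebra_simps power2_eq_square)
    qed
    \<comment> \<open>Fix one positive and one negative coefficient; either of the other two gaps
      can be contracted.\<close>
    moreover have "mixed3 c2 c3 c4 \<or> mixed3 c1 c3 c4 \<or> mixed3 c1 c2 c4 \<or> mixed3 c1 c2 c3"
      using P N unfolding mixed3_def by linarith
    ultimately show ?thesis
      using small_model_via_contraction_vec[of q x c1 c2 c3 c4 "q - 1" q] inner_bound_variation[OF V] q x True
      unfolding c by auto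
  next
    case False
    have "\<not> (c1 > 0 \<and> c4 > 0)" "\<not> (c1 < 0 \<and> c4 < 0)"
      using False inner_bound_ends[OF V] by blast+
    then consider "c1 \<ge> 0" "c4 \<le> 0" | "c1 \<le> 0" "c4 \<ge> 0" by linarith
    then show ?thesis
    proof cases
      case 1
      then show ?thesis using small_model_relation_oriented[OF q V 1 _ _ False] P N x unfolding c by auto
    next
      case 2
      have "has_small_model q (int_vec (-c1) (-c2) (-c3) (-c4))"
      proof (rule small_model_relation_oriented[OF q])
        show "variation (-c1) (-c2) (-c3) (-c4) \<le> 2 * q" using V by (simp add: variation_def abs_minus_commute)
        show "\<not> inner_bound (-c1) (-c2) (-c3) (-c4) (q - 1)"
          using False by (simp add: inner_bound_minus)
        show "x \<in> annihilator {int_vec (-c1) (-c2) (-c3) (-c4)}" using ker by (simp add: xx annihilator_vec)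
      qed (use 2 P N x in auto)
      moreover have "int_vec (-c1) (-c2) (-c3) (-c4) = - a" by (simp add: c int_vec_def)
      ultimately show ?thesis using small_model_uminus by metis
    qed
  qed
qed

section \<open>The two bounds\<close>

lemma annihilator_span: "c \<in> span B \<Longrightarrow> y \<in> annihilator B \<Longrightarrow> c \<bullet> y = 0"
  using orthogonal_to_span[of c B y] by (metis (mono_tags, lifting) inner_commute annihilator_def mem_Collect_eq orthogonal_def)

text \<open>\<open>B\<close> is a basis of the relations holding at \<open>x\<close>. A point of its
  annihilator satisfies all of them, and it satisfies no others if every relation vanishing there
  vanishes on the whole annihilator, which contains \<open>x\<close>. The construction depends on
  the rank \<open>card B\<close>.\<close>

lemma gap_model:
  assumes q: "q \<ge> 2" and x: "pos_vec x"
  shows "\<exists>y. pos_vec y \<and> integral_vec y \<and> gap_sum y \<le> of_int (q\<^sup>2 * (q + 1)) \<and>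
    (\<forall>c\<in>relations q. c \<bullet> y = 0 \<longleftrightarrow> c \<bullet> x = 0)"
proof -
  define T where "T = {c \<in> relations q. c \<bullet> x = 0}"
  obtain B where B: "B \<subseteq> T" "independent B" "T \<subseteq> span B"
    using maximal_independent_subset by blast
  have q1: "q \<ge> 1" using q by simp
  have xB: "x \<in> annihilator B" using B(1) by (auto simp: annihilator_def T_def)
  have nx: "nonneg_vec x" using x by (auto simp: pos_vec_def nonneg_vec_def intro: less_imp_le)
  have x0: "x \<noteq> 0" using x by (auto simp: pos_vec_def coords_def zero_prod_def)
  have fB: "finite B" using B(2) independent_bound by blast
  \<comment> \<open>The nonzero vector \<open>x\<close> lies in the annihilator, so at most three
    relations are independent.\<close>
  have "dim {x. \<forall>c\<in>B. c \<bullet> x = 0} \<noteq> 0"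
    using xB x0 by (auto simp: annihilator_def dim_eq_0)
  moreover have "dim {x. \<forall>c\<in>B. c \<bullet> x = 0} + card B = 4" using dim_annihilator[OF B(2)] by simp
  ultimately have card: "card B \<le> 3" by linarith
  have "\<exists>y\<in>annihilator B. nonneg_vec y \<and> integral_vec y \<and> gap_sum y \<le> of_int (q\<^sup>2 * (q + 1)) \<and>
    (\<forall>c\<in>relations q. c \<bullet> y = 0 \<longrightarrow> (\<forall>x\<in>annihilator B. c \<bullet> x = 0))"
  proof -
    consider "card B = 0" | "card B = 1" | "card B = 2" | "card B = 3" using card by linarith
    then show ?thesis
    proof cases
      case 1
      then have B0: "B = {}" using fB by simp
      let ?y = "int_vec 1 q (q\<^sup>2) (q ^ 3 - q - 1)"
      have "2 * q \<le> q * q" by (rule mult_right_mono) (use q in auto)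
      moreover have "(2 * q) * q \<le> (q * q) * q" using calculation by (rule mult_right_mono) (use q in auto)
      ultimately have "q ^ 3 - q - 1 \<ge> 0" using q unfolding power3_eq_cube by linarith
      then have "nonneg_vec ?y" using q by (simp add: nonneg_vec_vec)
      moreover have "gap_sum ?y \<le> of_int (q\<^sup>2 * (q + 1))"
        unfolding gap_sum_vec of_int_le_iff by (simp add: power2_eq_square power3_eq_cube algebra_simps)
      moreover have "c \<bullet> z = 0" if "c \<in> relations q" "c \<bullet> ?y = 0" for c z
      proof -
        obtain d1 d2 d3 d4 where d: "c = int_vec d1 d2 d3 d4" "variation d1 d2 d3 d4 \<le> 2 * q"
          using \<open>c \<in> relations q\<close> by (rule relationsE)
        have "d1 * 1 + d2 * q + d3 * q\<^sup>2 + d4 * (q ^ 3 - q - 1) = 0"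
          using \<open>c \<bullet> ?y = 0\<close> unfolding d(1) inner_vec_vec of_int_eq_0_iff .
        then have "d1 + q * d2 + q\<^sup>2 * d3 + (q ^ 3 - q - 1) * d4 = 0" by (simp add: mult.commute)
        then show ?thesis using generic_free[OF q d(2)] by (cases z) (simp add: d(1) inner_vec)
      qed
      ultimately show ?thesis using B0 integral_vec_vec by (intro bexI[of _ ?y]) (auto simp: annihilator_def)
    next
      case 2
      then obtain a where a: "B = {a}" by (auto simp: card_1_singleton_iff)
      have "a \<in> relations q" "a \<noteq> 0" using B(1,2) dependent_zero[of B] by (auto simp: a T_def)
      then have "has_small_model q a" using small_model_relation[OF q] xB x by (simp add: a)
      then show ?thesis unfolding has_small_model_def a by blast
    next
      case 3
      then obtain a b where ab: "B = {a, b}" "a \<noteq> b" by (auto simp: card_2_iff)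
      have r: "a \<in> relations q" "b \<in> relations q" using B(1) by (auto simp: ab T_def)
      have "\<exists>y\<in>annihilator {a, b}. nonneg_vec y \<and> integral_vec y \<and> gap_sum y \<le> of_int q * of_int q * (1 + of_int q) \<and>
        (\<forall>c\<in>relations q. c \<bullet> y = 0 \<longrightarrow> (\<forall>x\<in>annihilator {a, b}. c \<bullet> x = 0))"
      proof (rule plane_model[where t = x])
        show "e \<bullet> z = 0" if "e \<in> coords" "e \<bullet> x = 0" for e z
          using that x by (auto simp: pos_vec_def)
      qed (use r ab B(2) xB nx x0 q1 in \<open>simp_all add: finite_relations coords_relations relations_integral relations_mid_bound\<close>)
      moreover have "real_of_int q * of_int q * (1 + of_int q) = of_int (q\<^sup>2 * (q + 1))"
        by (simp add: power2_eq_square algebra_simps)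
      ultimately show ?thesis unfolding ab(1) by simp
    next
      case 4
      have line: "\<exists>\<mu>. d = \<mu> *\<^sub>R x" if "d \<in> annihilator B" for d
        using that xB x0 4 by (intro annihilator_line[OF B(2)]) (auto simp: annihilator_def)
      have r: "c \<in> relations q" if "c \<in> B" for c using B(1) that by (auto simp: T_def)
      obtain B' k where B': "B \<subseteq> B'" "B' \<subseteq> B" "card B' = 3" and k: "k > 0" "integral_vec (k *\<^sub>R x)"
        "\<bar>gap_sum (k *\<^sub>R x)\<bar> \<le> (\<Prod>c\<in>B'. of_int q)"
      proof (rule integral_ray[OF order_refl B(2) x0, where h = "\<lambda>_. of_int q"])
        show "c \<bullet> x = 0" if "c \<in> B" for c using that xB by (simp add: annihilator_def)
        show "\<exists>\<mu>. d = \<mu> *\<^sub>R x" if "\<forall>c\<in>B. c \<bullet> d = 0" for d using that by (intro line) (simp add: annihilator_def)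
        show "integral_vec c" "mid_bound c (of_int q)" if "c \<in> B" for c
          using r[OF that] relations_integral relations_mid_bound by auto
      qed
      have "gap_sum (k *\<^sub>R x) \<le> of_int (q ^ 3)" using k(3) B'(3) by simp
      also have "\<dots> \<le> of_int (q\<^sup>2 * (q + 1))"
        unfolding of_int_le_iff by (simp add: power2_eq_square power3_eq_cube algebra_simps)
      finally have "gap_sum (k *\<^sub>R x) \<le> of_int (q\<^sup>2 * (q + 1))" .
      moreover have "k *\<^sub>R x \<in> annihilator B" using xB by (rule annihilator_arith)
      moreover have "nonneg_vec (k *\<^sub>R x)" using nx k(1) by (simp add: nonneg_vec_scale)
      moreover have "c \<bullet> z = 0" if "c \<bullet> (k *\<^sub>R x) = 0" "z \<in> annihilator B" for c z
        using line[OF that(2)] that(1) k(1) by auto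
      ultimately show ?thesis using k(2) by blast
    qed
  qed
  then obtain y where y: "y \<in> annihilator B" "nonneg_vec y" "integral_vec y" "gap_sum y \<le> of_int (q\<^sup>2 * (q + 1))"
    and gen: "\<forall>c\<in>relations q. c \<bullet> y = 0 \<longrightarrow> (\<forall>x\<in>annihilator B. c \<bullet> x = 0)" by blast
  have iff: "c \<bullet> y = 0 \<longleftrightarrow> c \<bullet> x = 0" if "c \<in> relations q" for c
    using that gen xB annihilator_span[OF _ y(1), of c] B(3) by (auto simp: T_def)
  \<comment> \<open>The coordinate functionals are relations that do not vanish at \<open>x\<close>,
    hence not at \<open>y\<close>.\<close>
  have "pos_vec y" unfolding pos_vec_def
  proof
    fix e assume e: "e \<in> coords"
    then have "e \<bullet> y \<noteq> 0" using iff[OF subsetD[OF coords_relations[OF q1] e]] x e by (auto simp: pos_vec_def)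
    then show "e \<bullet> y > 0" using y(2) e by (auto simp: nonneg_vec_def less_le)
  qed
  then show ?thesis using y iff by blast
qed

section \<open>From index lists to relations between gaps\<close>

lemma sum_list_count:
  fixes f :: "nat \<Rightarrow> 'a :: comm_semiring_1"
  assumes "set xs \<subseteq> {..<5}"
  shows "(\<Sum>i\<leftarrow>xs. f i) = of_nat (count_list xs 0) * f 0 + of_nat (count_list xs 1) * f 1 +
    of_nat (count_list xs 2) * f 2 + of_nat (count_list xs 3) * f 3 + of_nat (count_list xs 4) * f 4"
  using assms
proof (induction xs)
  case (Cons i xs)
  then have "i = 0 \<or> i = 1 \<or> i = 2 \<or> i = 3 \<or> i = 4" by auto
  then show ?case using Cons by (auto simp: algebra_simps)
qed simp

text \<open>A comparison of two index lists is the relation whose coefficient at a gap is the difference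
  of the numbers of indices to the right of that gap.\<close>

lemma list_relation:
  assumes "length is = h" "set is \<subseteq> {..<5}" "length js = h" "set js \<subseteq> {..<5}" "int h \<le> q"
  obtains c where "c \<in> relations q"
    "\<And>t :: nat \<Rightarrow> real. (\<Sum>i\<leftarrow>is. t i) - (\<Sum>j\<leftarrow>js. t j) = c \<bullet> (t 1 - t 0, t 2 - t 1, t 3 - t 2, t 4 - t 3)"
proof -
  define n where "n i = int (count_list is i) - int (count_list js i)" for i
  let ?one = "\<lambda>_. 1 :: int"
  have L: "int (length xs) = int (count_list xs 0) + int (count_list xs 1) + int (count_list xs 2) +
      int (count_list xs 3) + int (count_list xs 4)" if "set xs \<subseteq> {..<5}" for xs :: "nat list"
    using sum_list_count[OF that, of ?one] by (simp add: sum_list_triv)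
  have l: "int h = int (count_list is 0) + int (count_list is 1) + int (count_list is 2) +
      int (count_list is 3) + int (count_list is 4)"
    "int h = int (count_list js 0) + int (count_list js 1) + int (count_list js 2) +
      int (count_list js 3) + int (count_list js 4)"
    using L[OF assms(2)] L[OF assms(4)] assms(1,3) by simp_all
  \<comment> \<open>Equal lengths make the five differences sum to zero, so the variation of the
    partial sums is the sum of all \<bar>n i\<bar>, at most twice the length.\<close>
  have n0: "n 0 = - (n 1 + n 2 + n 3 + n 4)" using l by (simp add: n_def)
  have abs: "\<bar>n i\<bar> \<le> int (count_list is i) + int (count_list js i)" for i by (simp add: n_def)
  define c where "c = int_vec (n 1 + n 2 + n 3 + n 4) (n 2 + n 3 + n 4) (n 3 + n 4) (n 4)"
  have "\<bar>n 0\<bar> + \<bar>n 1\<bar> + \<bar>n 2\<bar> + \<bar>n 3\<bar> + \<bar>n 4\<bar> \<le> 2 * q"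
    using abs[of 0] abs[of 1] abs[of 2] abs[of 3] abs[of 4] l assms(5) by simp
  moreover have "\<bar>n 0\<bar> = \<bar>n 1 + n 2 + n 3 + n 4\<bar>" unfolding n0 by (rule abs_minus_cancel)
  ultimately have "variation (n 1 + n 2 + n 3 + n 4) (n 2 + n 3 + n 4) (n 3 + n 4) (n 4) \<le> 2 * q"
    unfolding variation_def by simp
  then have "c \<in> relations q" by (simp add: c_def relations_int_vec)
  moreover have "(\<Sum>i\<leftarrow>is. t i) - (\<Sum>j\<leftarrow>js. t j) = c \<bullet> (t 1 - t 0, t 2 - t 1, t 3 - t 2, t 4 - t 3)" for t :: "nat \<Rightarrow> real"
  proof -
    have r: "real (count_list is i) - real (count_list js i) = of_int (n i)" for i by (simp add: n_def)
    have "(\<Sum>i\<leftarrow>is. t i) - (\<Sum>j\<leftarrow>js. t j) = of_int (n 0) * t 0 + of_int (n 1) * t 1 + of_int (n 2) * t 2 +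
        of_int (n 3) * t 3 + of_int (n 4) * t 4"
      unfolding sum_list_count[OF assms(2)] sum_list_count[OF assms(4)] r[symmetric] by (simp add: algebra_simps)
    then show ?thesis unfolding c_def inner_vec n0 by (simp add: algebra_simps)
  qed
  ultimately show ?thesis using that by blast
qed

lemma upper_bound:
  assumes q: "q \<ge> 2"
  shows "diameter_bound 5 q ((int q)\<^sup>2 * (int q + 1))"
  unfolding diameter_bound_def
proof (intro allI impI)
  fix t :: "nat \<Rightarrow> real" assume t: "ordered_alphabet 5 t"
  have mono: "t 0 < t 1" "t 1 < t 2" "t 2 < t 3" "t 3 < t 4"
    using t by (auto simp: ordered_alphabet_def strict_mono_on_def)
  define x where "x = (t 1 - t 0, t 2 - t 1, t 3 - t 2, t 4 - t 3)"
  have px: "pos_vec x" using mono by (simp add: x_def pos_vec_simp)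
  have "int q \<ge> 2" using q by simp
  then obtain y where y: "pos_vec y" "integral_vec y" "gap_sum y \<le> of_int ((int q)\<^sup>2 * (int q + 1))"
    and iff: "\<And>c. c \<in> relations (int q) \<Longrightarrow> c \<bullet> y = 0 \<longleftrightarrow> c \<bullet> x = 0"
    using gap_model[OF _ px] by blast
  obtain y1 y2 y3 y4 where yy: "y = int_vec y1 y2 y3 y4" using y(2) by (rule integral_vecE)
  have pos: "y1 > 0" "y2 > 0" "y3 > 0" "y4 > 0" using y(1) by (simp_all add: yy int_vec_def pos_vec_simp)
  have tot: "y1 + y2 + y3 + y4 \<le> (int q)\<^sup>2 * (int q + 1)"
    using y(3) unfolding yy gap_sum_vec of_int_le_iff .
  define s :: "nat \<Rightarrow> int" where
    "s i = (if i = 0 then 0 else if i = 1 then y1 else if i = 2 then y1 + y2 else if i = 3 then y1 + y2 + y3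
      else y1 + y2 + y3 + y4)" for i
  have "order_preserving_model 5 q t s"
    unfolding order_preserving_model_def
  proof (intro conjI ballI allI impI)
    show "strict_mono_on {..<5} s"
    proof (rule strict_mono_onI)
      fix i j :: nat assume "i \<in> {..<5}" "j \<in> {..<5}" "i < j"
      moreover from this have "j = 1 \<or> j = 2 \<or> j = 3 \<or> j = 4" by auto
      ultimately show "s i < s j" using pos unfolding s_def by auto
    qed
    fix h and xs ys :: "nat list"
    assume "h \<in> {1..q}" and l: "length xs = h \<and> set xs \<subseteq> {..<5} \<and> length ys = h \<and> set ys \<subseteq> {..<5}"
    then have "int h \<le> int q" by simp
    then obtain c where c: "c \<in> relations (int q)"
      and eq: "\<And>t :: nat \<Rightarrow> real. (\<Sum>i\<leftarrow>xs. t i) - (\<Sum>j\<leftarrow>ys. t j) = c \<bullet> (t 1 - t 0, t 2 - t 1, t 3 - t 2, t 4 - t 3)"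
      using list_relation[of xs h ys "int q"] l by metis
    have of: "real_of_int (\<Sum>i\<leftarrow>xs. s i) = (\<Sum>i\<leftarrow>xs. real_of_int (s i))" for xs :: "nat list"
      by (induction xs) auto
    have sy: "(real_of_int (s 1) - of_int (s 0), real_of_int (s 2) - of_int (s 1), real_of_int (s 3) - of_int (s 2),
        real_of_int (s 4) - of_int (s 3)) = y"
      by (simp add: s_def yy int_vec_def)
    have "(\<Sum>i\<leftarrow>xs. t i) = (\<Sum>j\<leftarrow>ys. t j) \<longleftrightarrow> c \<bullet> x = 0" using eq[of t] by (auto simp: x_def)
    also have "\<dots> \<longleftrightarrow> c \<bullet> y = 0" using iff[OF c] by simp
    also have "\<dots> \<longleftrightarrow> (\<Sum>i\<leftarrow>xs. real_of_int (s i)) = (\<Sum>j\<leftarrow>ys. real_of_int (s j))"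
      using eq[of "\<lambda>i. of_int (s i)"] unfolding sy by auto
    also have "\<dots> \<longleftrightarrow> (\<Sum>i\<leftarrow>xs. s i) = (\<Sum>j\<leftarrow>ys. s j)" unfolding of[symmetric] by simp
    finally show "((\<Sum>i\<leftarrow>xs. t i) = (\<Sum>j\<leftarrow>ys. t j)) = ((\<Sum>i\<leftarrow>xs. s i) = (\<Sum>j\<leftarrow>ys. s j))" .
  qed
  moreover have "diameter_of 5 s \<le> (int q)\<^sup>2 * (int q + 1)" using tot by (simp add: diameter_of_def s_def)
  ultimately show "\<exists>s. order_preserving_model 5 q t s \<and> diameter_of 5 s \<le> (int q)\<^sup>2 * (int q + 1)" by blast
qed

section \<open>An alphabet that forces the diameter\<close>

lemma lower_bound:
  assumes q: "q \<ge> 2" and D: "diameter_bound 5 q D"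
  shows "(int q)\<^sup>2 * (int q + 1) \<le> D"
proof -
  \<comment> \<open>From index 2 on the values form a geometric progression with ratio
    \<open>q\<close>, which supplies the two relations used in \<open>step\<close>.\<close>
  define t :: "nat \<Rightarrow> real" where
    "t i = (if i = 0 then 0 else if i = 1 then 1 else real ((q + 1) * q ^ (i - 2)))" for i
  have tv: "t 0 = 0" "t 1 = 1" "t 2 = real q + 1" "t 3 = real q * (real q + 1)" "t 4 = (real q)\<^sup>2 * (real q + 1)"
    by (simp_all add: t_def algebra_simps)
  have "ordered_alphabet 5 t"
    unfolding ordered_alphabet_def
  proof (rule strict_mono_onI)
    have "1 * (real q + 1) < real q * (real q + 1)" "real q * (real q + 1) < real q * (real q * (real q + 1))"
      using q by (intro mult_strict_right_mono mult_strict_left_mono; simp)+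
    then have m: "t 0 < t 1" "t 1 < t 2" "t 2 < t 3" "t 3 < t 4"
      using q unfolding tv by (simp_all add: power2_eq_square mult.assoc)
    fix i j :: nat assume "i \<in> {..<5}" "j \<in> {..<5}" "i < j"
    then have "i = 0 \<or> i = 1 \<or> i = 2 \<or> i = 3" "j = 1 \<or> j = 2 \<or> j = 3 \<or> j = 4" "i < j" by auto
    then show "t i < t j" using m by (elim disjE) auto
  qed
  then obtain s where s: "order_preserving_model 5 q t s" "diameter_of 5 s \<le> D"
    using D unfolding diameter_bound_def by blast
  have rel: "(\<Sum>i\<leftarrow>is. t i) = (\<Sum>j\<leftarrow>js. t j) \<longleftrightarrow> (\<Sum>i\<leftarrow>is. s i) = (\<Sum>j\<leftarrow>js. s j)"
    if "length is = h" "length js = h" "1 \<le> h" "h \<le> q" "set is \<subseteq> {..<5}" "set js \<subseteq> {..<5}" for h "is" js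
    using s(1) that unfolding order_preserving_model_def by auto
  have mono: "s 0 < s 1" "s 1 < s 2"
    using s(1) by (auto simp: order_preserving_model_def strict_mono_on_def)
  have step: "s (Suc k) - s 0 = int q * (s k - s 0)" if "k = 2 \<or> k = 3" for k
  proof -
    \<comment> \<open>Padding with \<open>t 0 = 0\<close> turns \<open>q * t k = t (Suc k)\<close>
      into a comparison of two lists of length \<open>q\<close>.\<close>
    have "(\<Sum>i\<leftarrow>replicate q k. t i) = (\<Sum>j\<leftarrow>Suc k # replicate (q - 1) 0. t j)"
      using that q by (auto simp: sum_list_replicate t_def of_nat_diff power2_eq_square algebra_simps)
    then have "(\<Sum>i\<leftarrow>replicate q k. s i) = (\<Sum>j\<leftarrow>Suc k # replicate (q - 1) 0. s j)"
      using that q by (subst (asm) rel[of _ q]) auto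
    then show ?thesis using q by (simp add: sum_list_replicate of_nat_diff algebra_simps)
  qed
  define a b where "a = nat (s 1 - s 0)" and "b = nat (s 2 - s 0)"
  have ab: "int a = s 1 - s 0" "int b = s 2 - s 0" "0 < a" "a < b" using mono by (auto simp: a_def b_def)
  have "b > q"
  proof (rule ccontr)
    assume "\<not> b > q"
    \<comment> \<open>The identity \<open>b * (s 1 - s 0) = a * (s 2 - s 0)\<close>, written with
      lists of length \<open>b\<close>. For \<open>b \<le> q\<close> it transfers to
      \<open>t\<close> and yields \<open>b = a * (q + 1)\<close>, which exceeds
      \<open>q\<close>.\<close>
    have "(\<Sum>i\<leftarrow>replicate b 1. s i) = (\<Sum>j\<leftarrow>replicate a 2 @ replicate (b - a) 0. s j)"
    proof -
      have "int b * s 1 = int a * s 2 + (int b - int a) * s 0" unfolding ab(1,2) by (simp add: algebra_simps)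
      then show ?thesis using ab(4) by (simp add: sum_list_replicate of_nat_diff)
    qed
    then have "(\<Sum>i\<leftarrow>replicate b 1. t i) = (\<Sum>j\<leftarrow>replicate a 2 @ replicate (b - a) 0. t j)"
      using ab \<open>\<not> b > q\<close> by (subst rel[of _ b]) auto
    then have "real b = real a * (real q + 1)" using tv by (simp add: sum_list_replicate)
    then have "b = a * (q + 1)" by (metis of_nat_1 of_nat_add of_nat_eq_iff of_nat_mult)
    then have "b \<ge> q + 1" using ab(3) by (cases a) auto
    then show False using \<open>\<not> b > q\<close> by simp
  qed
  have "diameter_of 5 s = int q * (int q * int b)"
    using step[of 2] step[of 3] by (simp add: diameter_of_def ab)
  moreover have "int q * (int q * int b) \<ge> int q * (int q * (int q + 1))"
    using \<open>b > q\<close> by (intro mult_left_mono) auto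
  ultimately show ?thesis using s(2) by (simp add: power2_eq_square mult.assoc)
qed

theorem theorem2:
  fixes q :: nat
  assumes "q \<ge> 2"
  shows "diameter_bound 5 q (H 5 q) \<and> H 5 q = (int q)^2 * (int q + 1)"
proof -
  have "H 5 q = (int q)\<^sup>2 * (int q + 1)"
    unfolding H_def using upper_bound[OF assms] lower_bound[OF assms] by (intro Least_equality)
  then show ?thesis using upper_bound[OF assms] by simp
qed

end
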